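(* Let $\sigma^2>0$ be such that $\mathcal{C}(\sigma^2)\ge 4.26$. Consider the coupled system with binary (2-PAM) symbols, $L\ge 2$ data streams and repetition factor $M\ge 2$, operated at its limiting load, i.e. $\alpha'=\frac{L-1}{M-1}=\bar\alpha(\sigma'^2)$ with $\sigma'^2=\sigma^2\frac{L}{L-1}$, and let $\mathcal{R}(\bar\alpha,\sigma^2)$ denote its achievable sum-rate at this load. There exists $\bar W>0$ such that for any coupling window $W>\bar W$ $$\mathcal{C}(\sigma^2)-\mathcal{R}(\bar\alpha,\sigma^2)\ \le\ \mathcal{G}_{\text{asymptotic}}(\sigma^2)+\mathcal{G}_{\text{finite}}(L,M,\sigma^2),$$ where $$\mathcal{G}_{\text{asymptotic}}(\sigma^2)=\frac{1.081}{\mathcal{C}(\sigma^2)},\qquad \mathcal{G}_{\text{finite}}(L,M,\sigma^2)=\frac12\log_2\left(\frac{\sigma^2+1}{\sigma^2+1-\frac1L}\right)+\frac{\mathcal{C}(\sigma^2)-1}{M-1}.$$ Consequently, $\lim_{L,M\to\infty}\mathcal{G}_{\text{finite}}(L,M,\sigma^2)=0$ (for fixed $\sigma^2$) and $\lim_{\sigma^2\to0}\mathcal{G}_{\text{asymptotic}}(\sigma^2)=0$.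
   Context: Capacity of the AWGN channel with signal power $1$ and noise power $s>0$: $\mathcal{C}(s)=\frac12\log_2\left(1+\frac1s\right)$. $\mathcal{C}_{\text{BIAWGN}}(\gamma)$ is the capacity in bits of the binary-input AWGN channel at SNR $\gamma$, i.e. $I(X;\sqrt{\gamma}X+Z)$ with $X$ uniform on $\{\pm1\}$ and $Z\sim\mathcal N(0,1)$ independent. The binary MSE function is $g_2(\gamma)=\mathbb{E}\left[(1-\tanh(\gamma+\xi\sqrt\gamma))^2\right]$, $\xi\sim\mathcal N(0,1)$. System parameters: $L$ is the number of superimposed equal-power data streams, $M$ the symbol repetition factor, $W$ the coupling window; $\alpha=L/M$, $\alpha'=\frac{L-1}{M-1}$, $\sigma'^2=\sigma^2\frac{L}{L-1}$. The characteristic equation is $$x=g_2\left(\frac{1}{\alpha' x}\right)+\sigma'^2 ,$$ and $x^{(1)}=x^{(1)}(\alpha',\sigma'^2)$ and $x^{(3)}=x^{(3)}(\alpha',\sigma'^2)$ denote its smallest and largest solutions. The coupled system with window $W$ is described by the recursion $$x_i^t=\frac{1}{2W+1}\sum_{\tau_1=-W}^{W}g_2\left(\frac{1}{\alpha'}\frac{1}{2W+1}\sum_{\tau_2=-W}^{W}\frac{1}{x_{i-1}^{t+\tau_1+\tau_2}}\right)+\sigma'^2,$$ with $x_0^t=0$ for $t\le0$, $x_0^t=\frac{t}{2W+1}+\sigma'^2$ for $1\le t\le 2W+1$, $x_0^t=1+\sigma'^2$ for $t>2W+1$; $x_i^t$ is the noise-and-interference power in section $t$ at demodulation iteration $i$.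 Potential function, for $x\ge0$: $$U(x,\alpha')=\ln\frac{x+x^{(1)}}{x^{(1)}}-\frac{\sigma'^2x}{x^{(1)}(x+x^{(1)})}-\alpha'\int_{\frac{1}{\alpha'(x+x^{(1)})}}^{\frac{1}{\alpha'x^{(1)}}}g_2(y)\,dy .$$ The limiting load is $\bar\alpha(\sigma'^2)=\sup\{\alpha'\in(0,\mathcal{C}(\sigma'^2)]:\ \min_{x\in[0,1+\sigma'^2]}U(x,\alpha')\ge0\}$. Achievable sum-rate (two-stage demodulation/decoding, capacity-achieving component codes): the coupled recursion is driven to the smallest fixed point $x^{(1)}$ when the load does not exceed $\bar\alpha$ and the window is sufficiently large, and to $x^{(3)}$ otherwise; accordingly the sum-rate is $$\mathcal{R}(\cdot,\sigma^2)=\begin{cases}\alpha\,\mathcal{C}_{\text{BIAWGN}}\left(\frac{1}{\alpha'x^{(1)}}\right), & \alpha'\le\bar\alpha(\sigma'^2)\ \text{and}\ W\ge\bar W,\\[1mm] \alpha\,\mathcal{C}_{\text{BIAWGN}}\left(\frac{1}{\alpha'x^{(3)}}\right), & \text{otherwise,}\end{cases}$$ where $\bar W$ is a sufficiently large window size (the $\bar W$ of the claim). Thus at load $\alpha'=\bar\alpha$ with $W>\bar W$ the rate is $\mathcal{R}(\bar\alpha,\sigma^2)=\frac{L}{M}\,\mathcal{C}_{\text{BIAWGN}}\left(\frac{1}{\bar\alpha\, x^{(1)}(\bar\alpha,\sigma'^2)}\right)$. *)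

theory Defs
  imports "HOL-Probability.Probability"
begin

definition capacity :: "real \<Rightarrow> real" where
  "capacity s = 1/2 * log 2 (1 + 1/s)"

text \<open>The sample space of the binary-input AWGN channel consists of the pairs (X, Z) of a uniform
  input on the two symbols and an independent standard normal noise variable.\<close>

definition biawgn_space :: "(real \<times> real) measure" where
  "biawgn_space = uniform_count_measure {-1, 1} \<Otimes>\<^sub>M std_normal_distribution"

definition capacity_biawgn :: "real \<Rightarrow> real" where
  "capacity_biawgn \<gamma> =
     prob_space.mutual_information biawgn_space 2 (count_space {-1, 1}) borel
       (\<lambda>(X, Z). X) (\<lambda>(X, Z). sqrt \<gamma> * X + Z)"

definition g2 :: "real \<Rightarrow> real" where
  "g2 \<gamma> = (\<integral>\<xi>. (1 - tanh (\<gamma> + \<xi> * sqrt \<gamma>))\<^sup>2 \<partial>std_normal_distribution)"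

text \<open>In the following, \<open>a\<close> is the load (written alpha prime in the usual notation) and \<open>s\<close> the
  noise power (sigma prime squared). Only positive solutions of the characteristic equation are
  considered, since \<open>x\<close> is a noise-and-interference power; this also keeps the argument
  of \<^const>\<open>g2\<close> in its proper domain. All these solutions lie in the compact interval between
  \<open>s\<close> and \<open>1 + s\<close>, and they form a nonempty closed set for positive \<open>a\<close> and \<open>s\<close>, so the
  smallest and the largest one exist.\<close>

definition char_solution :: "real \<Rightarrow> real \<Rightarrow> real \<Rightarrow> bool" where
  "char_solution a s x \<longleftrightarrow> 0 < x \<and> x = g2 (1 / (a * x)) + s"

definition x1 :: "real \<Rightarrow> real \<Rightarrow> real" where
  "x1 a s = (LEAST x. char_solution a s x)"

definition x3 :: "real \<Rightarrow> real \<Rightarrow> real" where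
  "x3 a s = (GREATEST x. char_solution a s x)"

definition potential :: "real \<Rightarrow> real \<Rightarrow> real \<Rightarrow> real" where
  "potential s x a =
     ln ((x + x1 a s) / x1 a s) - s * x / (x1 a s * (x + x1 a s))
     - a * integral {1 / (a * (x + x1 a s)) .. 1 / (a * x1 a s)} g2"

text \<open>The minimum of the potential over the compact interval is attained by continuity; it is
  nonnegative iff all values are.\<close>

definition limiting_load :: "real \<Rightarrow> real" where
  "limiting_load s =
     Sup {a \<in> {0<..capacity s}. \<forall>x\<in>{0..1 + s}. 0 \<le> potential s x a}"

definition load' :: "nat \<Rightarrow> nat \<Rightarrow> real" where
  "load' L M = (real L - 1) / (real M - 1)"

definition noise' :: "nat \<Rightarrow> real \<Rightarrow> real" where
  "noise' L \<sigma>2 = \<sigma>2 * (real L / (real L - 1))"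

text \<open>The achievable sum-rate of the system with coupling window \<open>W\<close>; \<open>Wbar\<close> is the window size from
  which on the coupled demodulation is taken to reach the smallest fixed point at all loads up to
  the limiting load. The arguments \<open>\<sigma>2\<close> here and below are noise powers, i.e. sigma squared.\<close>

definition sum_rate :: "nat \<Rightarrow> nat \<Rightarrow> nat \<Rightarrow> nat \<Rightarrow> real \<Rightarrow> real" where
  "sum_rate Wbar W L M \<sigma>2 =
     (if load' L M \<le> limiting_load (noise' L \<sigma>2) \<and> W \<ge> Wbar
      then real L / real M * capacity_biawgn (1 / (load' L M * x1 (load' L M) (noise' L \<sigma>2)))
      else real L / real M * capacity_biawgn (1 / (load' L M * x3 (load' L M) (noise' L \<sigma>2))))"

definition gap_asymptotic :: "real \<Rightarrow> real" where
  "gap_asymptotic \<sigma>2 = 1.081 / capacity \<sigma>2"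

definition gap_finite :: "nat \<Rightarrow> nat \<Rightarrow> real \<Rightarrow> real" where
  "gap_finite L M \<sigma>2 =
     1/2 * log 2 ((\<sigma>2 + 1) / (\<sigma>2 + 1 - 1 / real L)) + (capacity \<sigma>2 - 1) / (real M - 1)"

end

theory Submission
  imports Defs "HOL-Real_Asymp.Real_Asymp"
begin

text \<open>The limiting load is bounded from below by exhibiting a load \<open>a\<close> with nonnegative potential.
  In terms of the signal-to-noise ratio \<open>u = 1 / (a * (x + x1))\<close>, with \<open>v = 1 / (a * x1)\<close>, the
  potential is the integral of \<open>1 / y - a * s - a * g2 y\<close> over \<open>{u..v}\<close>. Tilting and symmetrising
  the Gaussian gives \<open>g2 y = exp (- y / 2) * E (sech (sqrt y * t))\<close>, hence
  \<open>exp (- y) \<le> g2 y \<le> exp (- y / 2)\<close>, and \<open>g2\<close> has total integral \<open>2 * ln 2\<close> (the I-MMSE relation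
  for one bit). As \<open>ln (1 + 1 / s) = 2 * ln 2 * c\<close> for the capacity \<open>c\<close>, the terms linear in \<open>a\<close>
  and \<open>c\<close> cancel, and the potential at small \<open>u\<close> is about \<open>2 * ln 2 * (c - a)\<close> plus
  \<open>- ln (a * u) - 1 + a * (1 - exp (- u)) \<ge> - 1 / a\<close>. So \<open>a = c - 0.9 / c\<close> is admissible. At such
  loads \<open>x1\<close> is so close to \<open>s\<close> that the BPSK capacity is within \<open>s\<^sup>2 / ln 2\<close> of one bit.\<close>

section \<open>The binary MSE function\<close>

text \<open>The exact total \<open>2 * ln 2\<close> cannot be replaced by a cheap one: integrating
  \<open>exp (- y / 2)\<close> gives 2, and for \<open>a\<close> near \<open>c\<close> the term
  \<open>2 * a\<close> exceeds the available \<open>2 * ln 2 * c\<close>. Nor does one estimate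
  serve all \<open>u\<close>. Reducing the potential to its leading terms uses
  \<open>s * a * (v - u) \<le> 1\<close>, which loses the fact that the potential vanishes at
  \<open>u = v\<close>; there \<open>- ln (a * u)\<close> is about \<open>- 2 * ln 2 * c\<close>,
  and the reduced bound is negative. Hence three ranges with \<open>D = ln (1 + 1 / s)\<close>: for
  \<open>u \<le> 4\<close> the exact total is needed; for \<open>u\<close> up to
  \<open>3.1 * D\<close> the surplus of order \<open>D\<close> pays for the crude exponential bound;
  beyond that the integrand itself is nonnegative. The gap has order \<open>1 / c\<close> because at
  \<open>a * u = 1\<close> the expression \<open>- ln (a * u) - 1 + a * (1 - exp (- u))\<close> is
  about \<open>- 1 / (2 * a)\<close>, a deficit that only \<open>2 * ln 2 * (c - a)\<close> can
  cover.\<close>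

lemma integral_std_normal_distribution:
  fixes f :: "real \<Rightarrow> real"
  assumes [measurable]: "f \<in> borel_measurable borel"
  shows "(\<integral>t. f t \<partial>std_normal_distribution) = (\<integral>t. std_normal_density t * f t \<partial>lborel)"
  by (subst integral_density) auto

lemma integrable_std_normal_bounded:
  fixes f :: "real \<Rightarrow> real"
  assumes [measurable]: "f \<in> borel_measurable borel" and "\<And>t. \<bar>f t\<bar> \<le> B"
  shows "integrable std_normal_distribution f"
proof -
  interpret real_distribution std_normal_distribution
    by (rule real_dist_normal_dist)
  show ?thesis
    by (rule integrable_const_bound[where B = B]) (use assms in auto)
qed

text \<open>Shift the variable by \<open>- sqrt \<gamma>\<close> and complete the square. Since mean
  and variance are both \<open>\<gamma>\<close>, the weight left over is \<open>exp w\<close> in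
  terms of the very argument \<open>w = sqrt \<gamma> * t\<close> of \<open>f\<close>.\<close>

lemma std_normal_tilt:
  fixes f :: "real \<Rightarrow> real"
  assumes [measurable]: "f \<in> borel_measurable borel" and "0 \<le> \<gamma>"
  shows "(\<integral>\<xi>. f (\<gamma> + \<xi> * sqrt \<gamma>) \<partial>std_normal_distribution) =
         exp (- \<gamma> / 2) * (\<integral>t. exp (sqrt \<gamma> * t) * f (sqrt \<gamma> * t) \<partial>std_normal_distribution)"
proof -
  have eq: "std_normal_density (- sqrt \<gamma> + 1 * t) * f (\<gamma> + (- sqrt \<gamma> + 1 * t) * sqrt \<gamma>)
        = exp (- \<gamma> / 2) * (std_normal_density t * (exp (sqrt \<gamma> * t) * f (sqrt \<gamma> * t)))" for t
  proof -
    have "- (- sqrt \<gamma> + 1 * t)\<^sup>2 / 2 = - \<gamma> / 2 + (- t\<^sup>2 / 2 + sqrt \<gamma> * t)"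
      using assms(2) by (simp add: power2_eq_square field_simps)
    then have "exp (- (- sqrt \<gamma> + 1 * t)\<^sup>2 / 2) = exp (- \<gamma> / 2) * (exp (- t\<^sup>2 / 2) * exp (sqrt \<gamma> * t))"
      by (simp only: exp_add)
    moreover have "\<gamma> + (- sqrt \<gamma> + 1 * t) * sqrt \<gamma> = sqrt \<gamma> * t"
      using assms(2) by (simp add: algebra_simps)
    ultimately show ?thesis
      unfolding std_normal_density_def by simp
  qed
  have "(\<integral>\<xi>. f (\<gamma> + \<xi> * sqrt \<gamma>) \<partial>std_normal_distribution) =
        (\<integral>\<xi>. std_normal_density \<xi> * f (\<gamma> + \<xi> * sqrt \<gamma>) \<partial>lborel)"
    by (rule integral_std_normal_distribution) measurable
  also have "\<dots> = (\<integral>t. std_normal_density (- sqrt \<gamma> + 1 * t) * f (\<gamma> + (- sqrt \<gamma> + 1 * t) * sqrt \<gamma>) \<partial>lborel)"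
    by (subst lborel_integral_real_affine[where c = 1 and t = "- sqrt \<gamma>"]) simp_all
  also have "\<dots> = exp (- \<gamma> / 2) * (\<integral>t. std_normal_density t * (exp (sqrt \<gamma> * t) * f (sqrt \<gamma> * t)) \<partial>lborel)"
    unfolding eq by simp
  also have "\<dots> = exp (- \<gamma> / 2) * (\<integral>t. exp (sqrt \<gamma> * t) * f (sqrt \<gamma> * t) \<partial>std_normal_distribution)"
    by (subst integral_std_normal_distribution) simp_all
  finally show ?thesis .
qed

lemma integral_std_normal_uminus:
  fixes f :: "real \<Rightarrow> real"
  assumes [measurable]: "f \<in> borel_measurable borel"
  shows "(\<integral>t. f (- t) \<partial>std_normal_distribution) = (\<integral>t. f t \<partial>std_normal_distribution)"
proof -
  have "(\<integral>t. f t \<partial>std_normal_distribution) = (\<integral>t. std_normal_density t * f t \<partial>lborel)"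
    by (rule integral_std_normal_distribution) simp
  also have "\<dots> = (\<integral>t. std_normal_density t * f (- t) \<partial>lborel)"
    by (subst lborel_integral_real_affine[where c = "-1" and t = 0]) (simp_all add: std_normal_density_def)
  also have "\<dots> = (\<integral>t. f (- t) \<partial>std_normal_distribution)"
    by (subst integral_std_normal_distribution) simp_all
  finally show ?thesis ..
qed

definition sech_mean :: "real \<Rightarrow> real" where
  "sech_mean \<gamma> = (\<integral>t. 1 / cosh (sqrt \<gamma> * t) \<partial>std_normal_distribution)"

lemma integrable_sech: "integrable std_normal_distribution (\<lambda>t. 1 / cosh (c * t :: real))"
proof (rule integrable_std_normal_bounded[where B = 1])
  show "(\<lambda>t. 1 / cosh (c * t)) \<in> borel_measurable borel"
    by (intro borel_measurable_continuous_onI continuous_intros) auto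
  show "\<bar>1 / cosh (c * t)\<bar> \<le> 1" for t
    using cosh_real_ge_1[of "c * t"] by simp
qed

text \<open>Since \<open>1 - tanh w = exp (- w) / cosh w\<close>, the tilted integrand is
  \<open>exp (- w)\<close> over the square of \<open>cosh w\<close>. Adding its reflection makes the
  numerator \<open>2 * cosh w\<close>, which cancels one factor.\<close>

lemma exp_tanh_bounded: "exp w * (1 - tanh w)\<^sup>2 \<le> (2::real)"
  and exp_tanh_symmetrised:
    "exp w * (1 - tanh w)\<^sup>2 + exp (- w) * (1 - tanh (- w))\<^sup>2 = 2 / cosh (w::real)"
proof -
  have p: "exp w > 0" "cosh w > 0" by simp_all
  have e: "exp w * (1 - tanh w)\<^sup>2 = exp (- w) / (cosh w)\<^sup>2" for w :: real
  proof -
    have "1 - tanh w = exp (- w) / cosh w"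
      using cosh_real_pos[of w] by (simp add: tanh_def field_simps cosh_def sinh_def)
    then show ?thesis
      by (simp add: power_divide power2_eq_square exp_minus)
  qed
  have "exp (- w) \<le> 2 * cosh w"
    by (simp add: cosh_def)
  also have "\<dots> \<le> 2 * (cosh w)\<^sup>2"
    using cosh_real_ge_1[of w] by (simp add: power2_eq_square)
  finally show "exp w * (1 - tanh w)\<^sup>2 \<le> 2"
    using p unfolding e by (simp add: divide_le_eq)
  have "exp w + exp (- w) = 2 * cosh w"
    by (simp add: cosh_def)
  then have "exp (- w) / (cosh w)\<^sup>2 + exp w / (cosh w)\<^sup>2 = 2 * cosh w / (cosh w)\<^sup>2"
    by (simp add: add_divide_distrib[symmetric] add.commute)
  then show "exp w * (1 - tanh w)\<^sup>2 + exp (- w) * (1 - tanh (- w))\<^sup>2 = 2 / cosh w"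
    unfolding e using p by (simp add: e power2_eq_square)
qed

text \<open>Tilting the Gaussian to mean zero and symmetrising turns the MSE into an even integrand, which
  is then visibly decreasing in \<open>\<gamma>\<close>.\<close>

lemma g2_eq:
  assumes "0 \<le> \<gamma>"
  shows "g2 \<gamma> = exp (- \<gamma> / 2) * sech_mean \<gamma>"
proof -
  let ?h = "\<lambda>w::real. exp w * (1 - tanh w)\<^sup>2"
  let ?I = "\<integral>t. ?h (sqrt \<gamma> * t) \<partial>std_normal_distribution"
  have m0: "?h \<in> borel_measurable borel"
    by (intro borel_measurable_continuous_onI continuous_intros) auto
  have m1: "(\<lambda>w::real. (1 - tanh w)\<^sup>2) \<in> borel_measurable borel"
    by (intro borel_measurable_continuous_onI continuous_intros) auto
  have m: "(\<lambda>t. ?h (sqrt \<gamma> * t)) \<in> borel_measurable borel"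
    using m0 by measurable
  have i: "integrable std_normal_distribution (\<lambda>t. ?h (sqrt \<gamma> * t))"
    by (rule integrable_std_normal_bounded[OF m, where B = 2]) (use exp_tanh_bounded in \<open>simp add: abs_mult\<close>)
  have i': "integrable std_normal_distribution (\<lambda>t. ?h (sqrt \<gamma> * - t))"
  proof (rule integrable_std_normal_bounded[where B = 2])
    show "(\<lambda>t. ?h (sqrt \<gamma> * - t)) \<in> borel_measurable borel"
      using m0 by measurable
    show "\<bar>?h (sqrt \<gamma> * - t)\<bar> \<le> 2" for t
      using exp_tanh_bounded[of "sqrt \<gamma> * - t"] by (simp only: abs_mult abs_exp_cancel power2_abs abs_of_nonneg zero_le_power2)
  qed
  have g: "g2 \<gamma> = exp (- \<gamma> / 2) * ?I"
    unfolding g2_def by (rule std_normal_tilt[OF m1 assms])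
  have "?I + ?I = ?I + (\<integral>t. ?h (sqrt \<gamma> * - t) \<partial>std_normal_distribution)"
    using integral_std_normal_uminus[OF m] by simp
  also have "\<dots> = (\<integral>t. ?h (sqrt \<gamma> * t) + ?h (sqrt \<gamma> * - t) \<partial>std_normal_distribution)"
    by (rule Bochner_Integration.integral_add[OF i i', symmetric])
  also have "\<dots> = (\<integral>t. 2 * (1 / cosh (sqrt \<gamma> * t)) \<partial>std_normal_distribution)"
    by (intro Bochner_Integration.integral_cong refl)
      (use exp_tanh_symmetrised in \<open>simp\<close>)
  also have "\<dots> = 2 * sech_mean \<gamma>"
    unfolding sech_mean_def by (rule integral_mult_right_zero)
  finally have "?I = sech_mean \<gamma>" by simp
  with g show ?thesis by simp
qed

lemma sech_mean_nonneg: "0 \<le> sech_mean \<gamma>"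
  unfolding sech_mean_def by (intro Bochner_Integration.integral_nonneg) simp

lemma sech_mean_le_1: "sech_mean \<gamma> \<le> 1"
proof -
  interpret real_distribution std_normal_distribution by (rule real_dist_normal_dist)
  have "sech_mean \<gamma> \<le> (\<integral>t. 1 \<partial>std_normal_distribution)"
    unfolding sech_mean_def
    by (intro integral_mono integrable_sech) (simp_all add: cosh_real_ge_1)
  then show ?thesis using prob_space by simp
qed

lemma sech_mean_antimono:
  assumes "0 \<le> y" "y \<le> z"
  shows "sech_mean z \<le> sech_mean y"
  unfolding sech_mean_def
proof (intro integral_mono integrable_sech)
  fix t :: real
  have "cosh \<bar>sqrt y * t\<bar> \<le> cosh \<bar>sqrt z * t\<bar>"
    using assms by (intro cosh_real_nonneg_le_iff[THEN iffD2]) (auto simp: abs_mult intro!: mult_right_mono)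
  then show "1 / cosh (sqrt z * t) \<le> 1 / cosh (sqrt y * t)"
    by (intro divide_left_mono) (auto simp: cosh_real_pos)
qed

section \<open>Slope and decay of the MSE function\<close>

lemma tanh_real_le_self:
  fixes x :: real
  assumes "0 \<le> x"
  shows "tanh x \<le> x"
proof -
  have "0 - tanh 0 \<le> x - tanh x"
  proof (rule DERIV_nonneg_imp_nondecreasing[OF assms])
    fix y :: real
    have "((\<lambda>x. x - tanh x) has_real_derivative (tanh y)\<^sup>2) (at y)"
      by (auto intro!: derivative_eq_intros)
    then show "\<exists>D. ((\<lambda>x. x - tanh x) has_real_derivative D) (at y) \<and> 0 \<le> D"
      by (metis zero_le_power2)
  qed
  then show ?thesis by simp
qed

text \<open>As a function of \<open>x\<close>, \<open>1 / cosh (sqrt x * t)\<close> has slope at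
  least \<open>- t\<^sup>2 / 2\<close>, because \<open>tanh w\<close> is bounded by \<open>w\<close>
  for \<open>w = sqrt x * t\<close> and the factor \<open>1 / sqrt x\<close> cancels. The unit
  second moment then gives \<open>sech_mean\<close> the Lipschitz constant 1/2.\<close>

lemma sech_sqrt_diff:
  fixes t :: real
  assumes "0 < y" "y \<le> z"
  shows "1 / cosh (sqrt y * t) - 1 / cosh (sqrt z * t) \<le> (z - y) / 2 * t\<^sup>2"
proof -
  let ?f = "\<lambda>x. 1 / cosh (sqrt x * t) + x / 2 * t\<^sup>2"
  have "?f y \<le> ?f z"
  proof (rule DERIV_nonneg_imp_nondecreasing[OF assms(2)])
    fix x assume x: "y \<le> x" "x \<le> z"
    then have x0: "0 < x" using assms by simp
    let ?w = "sqrt x * t"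
    let ?D = "- (sinh ?w * (t / (2 * sqrt x))) / (cosh ?w)\<^sup>2 + t\<^sup>2 / 2"
    have d: "(?f has_real_derivative ?D) (at x)"
      using x0 by (auto intro!: derivative_eq_intros simp: power2_eq_square field_simps)
    have w: "tanh ?w * t \<le> sqrt x * t\<^sup>2"
    proof (cases "t \<ge> 0")
      case True
      then have "tanh ?w \<le> ?w" using x0 by (intro tanh_real_le_self) simp
      from mult_right_mono[OF this True] show ?thesis by (simp add: power2_eq_square)
    next
      case False
      then have "tanh (sqrt x * - t) \<le> sqrt x * - t" using x0 by (intro tanh_real_le_self) (simp add: mult_nonneg_nonpos)
      then have "?w \<le> tanh ?w" by simp
      from mult_right_mono_neg[OF this, of t] False show ?thesis by (simp add: power2_eq_square)
    qed
    have tt: "0 \<le> tanh ?w * t"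
      using x0 by (cases "t \<ge> 0") (auto simp: zero_le_mult_iff mult_le_0_iff)
    have "sinh ?w * (t / (2 * sqrt x)) / (cosh ?w)\<^sup>2 = (tanh ?w * t) / (2 * sqrt x) / cosh ?w"
      by (simp add: tanh_def power2_eq_square)
    also have "\<dots> \<le> (tanh ?w * t) / (2 * sqrt x)"
      using divide_left_mono[of 1 "cosh ?w" "tanh ?w * t / (2 * sqrt x)"] tt x0 cosh_real_ge_1[of ?w]
      by simp
    also have "\<dots> \<le> t\<^sup>2 / 2"
      using w x0 by (simp add: field_simps)
    finally have "0 \<le> ?D" by simp
    with d show "\<exists>D. (?f has_real_derivative D) (at x) \<and> 0 \<le> D" by blast
  qed
  then show ?thesis by (simp add: algebra_simps diff_divide_distrib)
qed

lemma std_normal_second_moment: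
  "(\<integral>t. t\<^sup>2 \<partial>std_normal_distribution) = 1" "integrable std_normal_distribution (\<lambda>t. t\<^sup>2)"
  using std_normal_distribution_even_moments[of 1] by simp_all

lemma sech_mean_diff:
  assumes "0 < y" "y \<le> z"
  shows "sech_mean y - sech_mean z \<le> (z - y) / 2"
proof -
  have "sech_mean y - sech_mean z =
      (\<integral>t. 1 / cosh (sqrt y * t) - 1 / cosh (sqrt z * t) \<partial>std_normal_distribution)"
    unfolding sech_mean_def by (intro Bochner_Integration.integral_diff[symmetric] integrable_sech)
  also have "\<dots> \<le> (\<integral>t. (z - y) / 2 * t\<^sup>2 \<partial>std_normal_distribution)"
    using sech_sqrt_diff[OF assms]
    by (intro integral_mono Bochner_Integration.integrable_diff integrable_sech)
      (auto intro!: integrable_mult_right std_normal_second_moment)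
  also have "\<dots> = (z - y) / 2"
    by (simp add: std_normal_second_moment)
  finally show ?thesis .
qed

lemma cosh_le_exp_sq: "cosh x \<le> exp (x\<^sup>2 / 2)" for x :: real
proof -
  have *: "cosh x \<le> exp (x\<^sup>2 / 2)" if "0 \<le> x" for x :: real
  proof -
    have "ln (cosh 0) - 0\<^sup>2 / 2 \<ge> ln (cosh x) - x\<^sup>2 / 2"
    proof (rule DERIV_nonpos_imp_nonincreasing[OF that])
      fix y :: real assume "0 \<le> y" "y \<le> x"
      have "((\<lambda>x. ln (cosh x) - x\<^sup>2 / 2) has_real_derivative tanh y - y) (at y)"
        by (auto intro!: derivative_eq_intros simp: tanh_def)
      with \<open>0 \<le> y\<close> show "\<exists>D. ((\<lambda>x. ln (cosh x) - x\<^sup>2 / 2) has_real_derivative D) (at y) \<and> D \<le> 0"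
        using tanh_real_le_self by auto
    qed
    then have "ln (cosh x) \<le> x\<^sup>2 / 2" by simp
    then have "exp (ln (cosh x)) \<le> exp (x\<^sup>2 / 2)" by (simp only: exp_le_cancel_iff)
    then show ?thesis by simp
  qed
  show ?thesis using *[of "\<bar>x\<bar>"] by simp
qed

text \<open>Jensen's inequality for \<open>E (exp (- \<gamma> t\<^sup>2 / 2))\<close>, by the tangent at \<open>t\<^sup>2 = 1\<close>.\<close>

lemma sech_mean_ge:
  assumes "0 \<le> \<gamma>"
  shows "exp (- \<gamma> / 2) \<le> sech_mean \<gamma>"
proof -
  interpret real_distribution std_normal_distribution by (rule real_dist_normal_dist)
  have "exp (- \<gamma> / 2) = (\<integral>t. exp (- \<gamma> / 2) * (1 + \<gamma> / 2) - exp (- \<gamma> / 2) * (\<gamma> / 2) * t\<^sup>2 \<partial>std_normal_distribution)"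
    using prob_space by (subst Bochner_Integration.integral_diff) (auto simp: std_normal_second_moment algebra_simps
      intro!: integrable_mult_right std_normal_second_moment)
  also have "\<dots> \<le> sech_mean \<gamma>"
    unfolding sech_mean_def
  proof (intro integral_mono integrable_sech Bochner_Integration.integrable_diff integrable_mult_right
      std_normal_second_moment integrable_const)
    fix t :: real
    have "exp (- \<gamma> / 2) * (1 + \<gamma> / 2) - exp (- \<gamma> / 2) * (\<gamma> / 2) * t\<^sup>2 =
          exp (- \<gamma> / 2) * (1 + (\<gamma> / 2 - \<gamma> / 2 * t\<^sup>2))"
      by (simp add: algebra_simps)
    also have "\<dots> \<le> exp (- \<gamma> / 2) * exp (\<gamma> / 2 - \<gamma> / 2 * t\<^sup>2)"
      by (intro mult_left_mono exp_ge_add_one_self) simp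
    also have "\<dots> = exp (- ((sqrt \<gamma> * t)\<^sup>2 / 2))"
      using assms by (simp add: exp_add[symmetric] power_mult_distrib)
    also have "\<dots> = 1 / exp ((sqrt \<gamma> * t)\<^sup>2 / 2)"
      by (simp add: exp_minus field_simps)
    also have "\<dots> \<le> 1 / cosh (sqrt \<gamma> * t)"
      by (intro divide_left_mono cosh_le_exp_sq) (auto simp: cosh_real_pos)
    finally show "exp (- \<gamma> / 2) * (1 + \<gamma> / 2) - exp (- \<gamma> / 2) * (\<gamma> / 2) * t\<^sup>2 \<le> 1 / cosh (sqrt \<gamma> * t)" .
  qed
  finally show ?thesis .
qed

lemma g2_ge: "0 \<le> \<gamma> \<Longrightarrow> exp (- \<gamma>) \<le> g2 \<gamma>"
  using mult_left_mono[OF sech_mean_ge, of \<gamma> "exp (- \<gamma> / 2)"]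
  by (simp add: g2_eq exp_add[symmetric])

lemma g2_le: "0 \<le> \<gamma> \<Longrightarrow> g2 \<gamma> \<le> exp (- \<gamma> / 2)"
  using mult_left_mono[OF sech_mean_le_1, of "exp (- \<gamma> / 2)" \<gamma>] by (simp add: g2_eq)

lemma g2_antimono: "0 \<le> y \<Longrightarrow> y \<le> z \<Longrightarrow> g2 z \<le> g2 y"
  by (auto simp: g2_eq intro!: mult_mono sech_mean_antimono sech_mean_nonneg)

lemma g2_pos: "0 \<le> \<gamma> \<Longrightarrow> 0 < g2 \<gamma>"
  by (rule less_le_trans[OF _ g2_ge]) simp_all

text \<open>The product rule for \<open>exp (- \<gamma> / 2) * sech_mean \<gamma>\<close> in
  integrated form: each factor contributes half of the slope. Keeping the decaying factor is what
  makes the estimate near the fixed point work.\<close>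

lemma g2_diff_le:
  assumes "0 < y" "y \<le> z"
  shows "g2 y - g2 z \<le> exp (- y / 2) * (z - y)"
proof -
  have "exp (- z / 2) = exp (- y / 2) * exp (- (z - y) / 2)"
    by (simp add: exp_add[symmetric] diff_divide_distrib)
  then have "g2 y - g2 z = exp (- y / 2) *
      ((sech_mean y - sech_mean z) + (1 - exp (- (z - y) / 2)) * sech_mean z)"
    using assms by (simp add: g2_eq algebra_simps)
  also have "\<dots> \<le> exp (- y / 2) * ((z - y) / 2 + (z - y) / 2 * 1)"
  proof (intro mult_left_mono add_mono mult_mono)
    show "1 - exp (- (z - y) / 2) \<le> (z - y) / 2"
      using exp_ge_add_one_self[of "- (z - y) / 2"] by (simp add: field_simps)
  qed (use assms sech_mean_diff sech_mean_le_1 sech_mean_nonneg in auto)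
  finally show ?thesis by simp
qed

lemma continuous_on_g2: "continuous_on {0<..} g2"
proof -
  have "1-lipschitz_on {0<..} g2"
  proof (rule lipschitz_onI)
    have *: "\<bar>g2 y - g2 z\<bar> \<le> \<bar>y - z\<bar>" if "0 < y" "y \<le> z" for y z
    proof -
      have "exp (- y / 2) * (z - y) \<le> 1 * (z - y)"
        using that by (intro mult_right_mono) auto
      with g2_diff_le[OF that] g2_antimono[of y z] that show ?thesis by simp
    qed
    fix y z :: real assume "y \<in> {0<..}" "z \<in> {0<..}"
    then show "dist (g2 y) (g2 z) \<le> 1 * dist y z"
      using *[of y z] *[of z y] by (cases "y \<le> z") (auto simp: dist_real_def abs_minus_commute)
  qed simp
  then show ?thesis by (rule lipschitz_on_continuous_on)
qed

section \<open>The total integral of the MSE function\<close>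

text \<open>Needed for the inverse Gaussian antiderivative below. Near \<open>y\<close> the
  distribution function is an integral from the arbitrary base point \<open>y - 1\<close> plus a
  constant, so the fundamental theorem applies locally.\<close>

lemma has_real_derivative_cdf_std_normal [derivative_intros]:
  assumes "(f has_real_derivative D) (at x within S)"
  shows "((\<lambda>x. cdf std_normal_distribution (f x)) has_real_derivative std_normal_density (f x) * D) (at x within S)"
proof -
  interpret real_distribution std_normal_distribution by (rule real_dist_normal_dist)
  have cont: "continuous_on A std_normal_density" for A
    unfolding normal_density_def by (intro continuous_intros) simp_all
  have "(cdf std_normal_distribution has_real_derivative std_normal_density y) (at y)" for y
  proof -
    have eq: "cdf std_normal_distribution z =
        integral {y - 1..z} std_normal_density + cdf std_normal_distribution (y - 1)"
      if "z \<in> {y - 1<..<y + 1}" for z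
    proof -
      have "cdf std_normal_distribution z - cdf std_normal_distribution (y - 1) = measure std_normal_distribution {y - 1<..z}"
        using that by (intro cdf_diff_eq) simp
      also have "\<dots> = (\<integral>x. indicator {y - 1<..z} x \<partial>std_normal_distribution)"
        by simp
      also have "\<dots> = (\<integral>x. std_normal_density x * indicator {y - 1<..z} x \<partial>lborel)"
        by (rule integral_std_normal_distribution) simp
      also have "\<dots> = (\<integral>x. indicator {y - 1..z} x *\<^sub>R std_normal_density x \<partial>lborel)"
      proof (rule Bochner_Integration.integral_cong_AE)
        show "AE x in lborel. std_normal_density x * indicator {y - 1<..z} x = indicator {y - 1..z} x *\<^sub>R std_normal_density x"
          using AE_lborel_singleton[of "y - 1"] by eventually_elim (auto split: split_indicator)
      qed auto
      also have "\<dots> = (LINT x:{y - 1..z}|lborel. std_normal_density x)"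
        unfolding set_lebesgue_integral_def ..
      also have "\<dots> = integral {y - 1..z} std_normal_density"
        by (rule set_borel_integral_eq_integral(2)) (rule borel_integrable_atLeastAtMost'[OF cont])
      finally show ?thesis by simp
    qed
    have "((\<lambda>z. integral {y - 1..z} std_normal_density) has_real_derivative std_normal_density y) (at y within {y - 1..y + 1})"
      by (rule integral_has_real_derivative[OF cont]) simp
    then have "((\<lambda>z. integral {y - 1..z} std_normal_density) has_real_derivative std_normal_density y) (at y)"
      by (subst (asm) at_within_Icc_at) auto
    then have d: "((\<lambda>z. integral {y - 1..z} std_normal_density + cdf std_normal_distribution (y - 1))
        has_real_derivative std_normal_density y) (at y)"
      by (auto intro!: derivative_eq_intros)
    show ?thesis
      by (rule has_field_derivative_transform_within_open[OF d, of "{y - 1<..<y + 1}"]) (use eq in auto)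
  qed
  from DERIV_chain2[OF this assms] show ?thesis .
qed

text \<open>This is the tilted Green's function of Brownian motion with unit drift. The antiderivative is
  that of the inverse Gaussian distribution.\<close>

lemma nn_integral_gaussian_time:
  fixes v :: real
  assumes "v \<noteq> 0"
  shows "(\<integral>\<^sup>+\<gamma>. ennreal (indicator {0<..} \<gamma> * (exp (- \<gamma> / 2) / sqrt \<gamma> * std_normal_density (v / sqrt \<gamma>))) \<partial>lborel)
       = ennreal (exp (- \<bar>v\<bar>))"
proof -
  interpret real_distribution std_normal_distribution by (rule real_dist_normal_dist)
  define w where "w = \<bar>v\<bar>"
  have w: "0 < w" using assms by (simp add: w_def)
  let ?\<Phi> = "cdf std_normal_distribution"
  let ?f = "\<lambda>\<gamma>. exp (- \<gamma> / 2) / sqrt \<gamma> * std_normal_density (v / sqrt \<gamma>)"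
  let ?F = "\<lambda>\<gamma>. exp w * ?\<Phi> (sqrt \<gamma> + w / sqrt \<gamma>) + exp (- w) * ?\<Phi> (sqrt \<gamma> - w / sqrt \<gamma>)"
  \<comment> \<open>Completing the square for both signs at once: the cross term
    \<open>c * w\<close> absorbs the prefactor, so both summands of the antiderivative carry the
    same density, and in the derivative the terms with \<open>?q\<close> cancel.\<close>
  have dens: "exp (c * w) * std_normal_density (sqrt x + c * w / sqrt x)
      = exp (- x / 2) * std_normal_density (v / sqrt x)"
    if "0 < x" "c = 1 \<or> c = -1" for x c
  proof -
    have "c * w + - (sqrt x + c * w / sqrt x)\<^sup>2 / 2 = - x / 2 + - (v / sqrt x)\<^sup>2 / 2"
      using that by (auto simp: power2_eq_square field_simps w_def)
    then have "exp (c * w) * exp (- (sqrt x + c * w / sqrt x)\<^sup>2 / 2) = exp (- x / 2) * exp (- (v / sqrt x)\<^sup>2 / 2)"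
      by (simp only: exp_add[symmetric])
    then show ?thesis unfolding std_normal_density_def by simp
  qed
  have der: "DERIV ?F x :> ?f x" if "0 < x" for x
  proof -
    let ?p = "1 / (2 * sqrt x)" and ?q = "w / (2 * x * sqrt x)"
    have "DERIV (\<lambda>\<gamma>. sqrt \<gamma> + w / sqrt \<gamma>) x :> ?p - ?q"
      "DERIV (\<lambda>\<gamma>. sqrt \<gamma> - w / sqrt \<gamma>) x :> ?p + ?q"
      using that by (auto intro!: derivative_eq_intros simp: field_simps)
    then have "DERIV ?F x :> exp w * (std_normal_density (sqrt x + w / sqrt x) * (?p - ?q)) +
        exp (- w) * (std_normal_density (sqrt x - w / sqrt x) * (?p + ?q))"
      by (intro DERIV_add DERIV_cmult has_real_derivative_cdf_std_normal)
    moreover have "exp w * (std_normal_density (sqrt x + w / sqrt x) * (?p - ?q)) +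
        exp (- w) * (std_normal_density (sqrt x - w / sqrt x) * (?p + ?q)) = ?f x"
    proof -
      let ?E = "exp (- x / 2) * std_normal_density (v / sqrt x)"
      have "exp w * std_normal_density (sqrt x + w / sqrt x) = ?E"
        "exp (- w) * std_normal_density (sqrt x - w / sqrt x) = ?E"
        using dens[OF that, of 1] dens[OF that, of "-1"] by simp_all
      then have "exp w * (std_normal_density (sqrt x + w / sqrt x) * (?p - ?q)) +
        exp (- w) * (std_normal_density (sqrt x - w / sqrt x) * (?p + ?q)) = ?E * (?p - ?q) + ?E * (?p + ?q)"
        by (simp only: mult.assoc[symmetric])
      also have "\<dots> = ?E * (2 * ?p)"
        by (simp only: distrib_left[symmetric]) simp
      also have "\<dots> = ?f x" by simp
      finally show ?thesis .
    qed
    ultimately show ?thesis by simp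
  qed
  \<comment> \<open>As \<open>w\<close> is positive, the second argument tends to minus infinity at
    0 and only the first summand survives.\<close>
  have lim0: "(?F \<longlongrightarrow> exp w) (at_right 0)"
  proof -
    have "filterlim (\<lambda>\<gamma>. sqrt \<gamma> + w / sqrt \<gamma>) at_top (at_right 0)"
      "filterlim (\<lambda>\<gamma>. sqrt \<gamma> - w / sqrt \<gamma>) at_bot (at_right 0)"
      using w by real_asymp+
    from filterlim_compose[OF cdf_lim_at_top_prob this(1)] filterlim_compose[OF cdf_lim_at_bot this(2)]
    have "(?F \<longlongrightarrow> exp w * 1 + exp (- w) * 0) (at_right 0)"
      by (intro tendsto_intros)
    then show ?thesis by simp
  qed
  have lim1: "(?F \<longlongrightarrow> exp w + exp (- w)) at_top"
  proof -
    have "filterlim (\<lambda>\<gamma>. sqrt \<gamma> + w / sqrt \<gamma>) at_top at_top"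
      "filterlim (\<lambda>\<gamma>. sqrt \<gamma> - w / sqrt \<gamma>) at_top at_top"
      using w by real_asymp+
    from filterlim_compose[OF cdf_lim_at_top_prob this(1)] filterlim_compose[OF cdf_lim_at_top_prob this(2)]
    have "(?F \<longlongrightarrow> exp w * 1 + exp (- w) * 1) at_top"
      by (intro tendsto_intros)
    then show ?thesis by simp
  qed
  have cont: "isCont ?f x" if "0 < x" for x
    using that unfolding std_normal_density_def by (intro continuous_intros) auto
  have FTC: "set_integrable lborel (einterval 0 \<infinity>) ?f" "(LBINT x=0..\<infinity>. ?f x) = (exp w + exp (- w)) - exp w"
  proof (rule_tac [1-2] interval_integral_FTC_nonneg[where F = ?F])
    show "((?F \<circ> real_of_ereal) \<longlongrightarrow> exp w) (at_right 0)"
      using lim0 by (simp only: zero_ereal_def ereal_tendsto_simps1)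
    \<comment> \<open>once for each of the two goals\<close>
    then show "((?F \<circ> real_of_ereal) \<longlongrightarrow> exp w) (at_right 0)" .
    show "((?F \<circ> real_of_ereal) \<longlongrightarrow> exp w + exp (- w)) (at_left \<infinity>)"
      using lim1 by (simp only: ereal_tendsto_simps1)
    then show "((?F \<circ> real_of_ereal) \<longlongrightarrow> exp w + exp (- w)) (at_left \<infinity>)" .
  qed (use der cont in \<open>auto simp: zero_ereal_def\<close>)
  have e: "einterval 0 \<infinity> = {0<..}"
    by (auto simp: einterval_def zero_ereal_def)
  have "(\<integral>\<^sup>+\<gamma>. ennreal (indicator {0<..} \<gamma> * ?f \<gamma>) \<partial>lborel) = ennreal (\<integral>\<gamma>. indicator {0<..} \<gamma> * ?f \<gamma> \<partial>lborel)"
    using FTC(1) by (intro nn_integral_eq_integral) (auto simp: set_integrable_def e split: split_indicator)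
  also have "(\<integral>\<gamma>. indicator {0<..} \<gamma> * ?f \<gamma> \<partial>lborel) = exp (- w)"
    using FTC(2) by (simp add: interval_lebesgue_integral_def set_lebesgue_integral_def e)
  finally show ?thesis by (simp add: w_def)
qed

text \<open>For positive \<open>v\<close> the integrand is the derivative of
  \<open>- ln (1 + exp (- 2 * v))\<close>, so each half line contributes
  \<open>ln 2\<close>.\<close>

lemma nn_integral_exp_sech:
  "(\<integral>\<^sup>+v. ennreal (exp (- \<bar>v\<bar>) / cosh v) \<partial>lborel) = ennreal (2 * ln 2)"
proof -
  let ?f = "\<lambda>v::real. exp (- \<bar>v\<bar>) / cosh v"
  have m: "?f \<in> borel_measurable borel"
    by (intro borel_measurable_continuous_onI continuous_intros) auto
  let ?F = "\<lambda>v::real. - ln (1 + exp (- 2 * v))"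
  have "(\<integral>\<^sup>+v. ennreal (exp (- v) / cosh v) * indicator {0..} v \<partial>lborel) = ennreal (0 - ?F 0)"
  proof (rule nn_integral_FTC_atLeast)
    show "(\<lambda>v::real. exp (- v) / cosh v) \<in> borel_measurable borel"
      by (intro borel_measurable_continuous_onI continuous_intros) auto
    show "DERIV ?F x :> exp (- x) / cosh x" for x :: real
    proof -
      have p: "1 + exp (- 2 * x) > 0" by (simp add: add_pos_pos)
      have "2 * exp (- 2 * x) / (1 + exp (- 2 * x)) = exp (- x) / cosh x"
      proof -
        have e: "exp (- 2 * x) = exp (- x) * exp (- x)" by (simp add: exp_add[symmetric])
        have "2 * exp (- x) * cosh x = 1 + exp (- 2 * x)"
          by (simp add: cosh_def distrib_left exp_add[symmetric])
        then have "2 * exp (- 2 * x) * cosh x = exp (- x) * (1 + exp (- 2 * x))"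
          unfolding e by (metis mult.assoc mult.commute)
        then show ?thesis
          using p by (subst frac_eq_eq) auto
      qed
      then show ?thesis using p by (auto intro!: derivative_eq_intros simp: mult.commute)
    qed
    show "(?F \<longlongrightarrow> 0) at_top" by real_asymp
  qed simp
  also have "ennreal (0 - ?F 0) = ennreal (ln 2)" by simp
  finally have "(\<integral>\<^sup>+v. ennreal (indicator {0..} v *\<^sub>R ?f v) \<partial>lborel) = ennreal (ln 2)"
    by (subst (asm) nn_integral_cong[where v = "\<lambda>v. ennreal (indicator {0..} v *\<^sub>R ?f v)"])
      (auto split: split_indicator)
  then have "has_bochner_integral lborel (\<lambda>v. indicator {0..} v *\<^sub>R ?f v) (ln 2)"
    using borel_measurable_scaleR[OF _ m, of "indicator {0..}"]
    by (intro has_bochner_integral_nn_integral) auto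
  then have "has_bochner_integral lborel ?f (2 *\<^sub>R ln 2)"
    by (rule has_bochner_integral_even_function) simp
  then show ?thesis
    by (subst nn_integral_eq_integral) (auto simp: has_bochner_integral_iff)
qed

text \<open>The substitution \<open>v = sqrt \<gamma> * t\<close> moves \<open>\<gamma>\<close> out
  of the \<open>cosh\<close> and into the Gaussian kernel. After exchanging the integrals, the
  kernel integrates over \<open>\<gamma>\<close> to \<open>exp (- \<bar>v\<bar>)\<close>, except at
  the null set \<open>v = 0\<close>. Working with nonnegative integrals makes the exchange free of
  integrability conditions.\<close>

lemma nn_integral_g2: "(\<integral>\<^sup>+\<gamma>. ennreal (indicator {0<..} \<gamma> * g2 \<gamma>) \<partial>lborel) = ennreal (2 * ln 2)"
proof -
  let ?k = "\<lambda>\<gamma> v. indicator {0<..} \<gamma> * (exp (- \<gamma> / 2) / sqrt \<gamma> * std_normal_density (v / sqrt \<gamma>))"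
  have m [measurable]: "(\<lambda>v::real. 1 / cosh v) \<in> borel_measurable borel"
    by (intro borel_measurable_continuous_onI continuous_intros) auto
  have inner: "ennreal (indicator {0<..} \<gamma> * g2 \<gamma>) = (\<integral>\<^sup>+v. ennreal (?k \<gamma> v * (1 / cosh v)) \<partial>lborel)" for \<gamma>
  proof (cases "0 < \<gamma>")
    case True
    let ?h = "\<lambda>v. ennreal (exp (- \<gamma> / 2) / sqrt \<gamma> * std_normal_density (v / sqrt \<gamma>) * (1 / cosh v))"
    have "ennreal (g2 \<gamma>) = ennreal (exp (- \<gamma> / 2)) * ennreal (\<integral>t. 1 / cosh (sqrt \<gamma> * t) \<partial>std_normal_distribution)"
      using True by (simp add: g2_eq sech_mean_def ennreal_mult')
    also have "ennreal (\<integral>t. 1 / cosh (sqrt \<gamma> * t) \<partial>std_normal_distribution)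
        = (\<integral>\<^sup>+t. ennreal (1 / cosh (sqrt \<gamma> * t)) \<partial>std_normal_distribution)"
      by (rule nn_integral_eq_integral[symmetric]) (auto intro: integrable_sech)
    also have "\<dots> = (\<integral>\<^sup>+t. ennreal (std_normal_density t) * ennreal (1 / cosh (sqrt \<gamma> * t)) \<partial>lborel)"
      using m by (subst nn_integral_density) auto
    also have "ennreal (exp (- \<gamma> / 2)) * \<dots> = (\<integral>\<^sup>+t. ennreal (exp (- \<gamma> / 2)) *
        (ennreal (std_normal_density t) * ennreal (1 / cosh (sqrt \<gamma> * t))) \<partial>lborel)"
      by (rule nn_integral_cmult[symmetric]) (use m in measurable)
    also have "\<dots> = (\<integral>\<^sup>+t. ennreal (sqrt \<gamma>) * ?h (0 + sqrt \<gamma> * t) \<partial>lborel)"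
      using True by (intro nn_integral_cong) (simp add: ennreal_mult'[symmetric])
    also have "\<dots> = ennreal (sqrt \<gamma>) * (\<integral>\<^sup>+t. ?h (0 + sqrt \<gamma> * t) \<partial>lborel)"
      by (rule nn_integral_cmult) (use m in measurable)
    also have "\<dots> = ennreal \<bar>sqrt \<gamma>\<bar> * (\<integral>\<^sup>+t. ?h (0 + sqrt \<gamma> * t) \<partial>lborel)"
      using True by simp
    also have "\<dots> = (\<integral>\<^sup>+v. ?h v \<partial>lborel)"
      using True by (intro nn_integral_real_affine[symmetric]) (use m in measurable)
    finally show ?thesis using True by simp
  qed simp
  have "(\<integral>\<^sup>+\<gamma>. ennreal (indicator {0<..} \<gamma> * g2 \<gamma>) \<partial>lborel) =
      (\<integral>\<^sup>+\<gamma>. \<integral>\<^sup>+v. ennreal (?k \<gamma> v * (1 / cosh v)) \<partial>lborel \<partial>lborel)"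
    by (simp only: inner)
  also have "\<dots> = (\<integral>\<^sup>+v. \<integral>\<^sup>+\<gamma>. ennreal (?k \<gamma> v * (1 / cosh v)) \<partial>lborel \<partial>lborel)"
    by (rule lborel_pair.Fubini'[symmetric]) measurable
  also have "\<dots> = (\<integral>\<^sup>+v. ennreal (exp (- \<bar>v\<bar>) / cosh v) \<partial>lborel)"
  proof (rule nn_integral_cong_AE, rule AE_mp[OF AE_lborel_singleton[of 0]], intro AE_I2 impI)
    fix v :: real assume "v \<noteq> 0"
    have "(\<integral>\<^sup>+\<gamma>. ennreal (?k \<gamma> v * (1 / cosh v)) \<partial>lborel) = (\<integral>\<^sup>+\<gamma>. ennreal (?k \<gamma> v) * ennreal (1 / cosh v) \<partial>lborel)"
      by (intro nn_integral_cong ennreal_mult) (auto split: split_indicator)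
    also have "\<dots> = ennreal (exp (- \<bar>v\<bar>)) * ennreal (1 / cosh v)"
      by (subst nn_integral_multc) (measurable, simp only: nn_integral_gaussian_time[OF \<open>v \<noteq> 0\<close>])
    also have "\<dots> = ennreal (exp (- \<bar>v\<bar>) / cosh v)"
      by (simp add: ennreal_mult'[symmetric])
    finally show "(\<integral>\<^sup>+\<gamma>. ennreal (?k \<gamma> v * (1 / cosh v)) \<partial>lborel) = ennreal (exp (- \<bar>v\<bar>) / cosh v)" .
  qed
  finally show ?thesis using nn_integral_exp_sech by simp
qed

section \<open>Upper bounds for the integral of the MSE function over an interval\<close>

lemma g2_integrable_on: "0 < u \<Longrightarrow> g2 integrable_on {u..v}"
  by (intro integrable_continuous_real continuous_on_subset[OF continuous_on_g2]) auto

lemma integral_g2_le_total: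
  assumes "0 < u"
  shows "integral {u..v} g2 \<le> 2 * ln 2"
proof -
  have cont: "continuous_on {u..v} g2"
    using assms by (intro continuous_on_subset[OF continuous_on_g2]) auto
  note si = borel_integrable_atLeastAtMost'[OF cont]
  have "integral {u..v} g2 = (\<integral>y. indicator {u..v} y * g2 y \<partial>lborel)"
    using set_borel_integral_eq_integral(2)[OF si] by (simp add: set_lebesgue_integral_def)
  then have "ennreal (integral {u..v} g2) = (\<integral>\<^sup>+y. ennreal (indicator {u..v} y * g2 y) \<partial>lborel)"
    using si assms by (subst nn_integral_eq_integral)
      (auto simp: set_integrable_def split: split_indicator intro!: less_imp_le g2_pos)
  also have "\<dots> \<le> (\<integral>\<^sup>+y. ennreal (indicator {0<..} y * g2 y) \<partial>lborel)"
    using assms by (intro nn_integral_mono ennreal_leI) (auto split: split_indicator intro!: less_imp_le g2_pos)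
  finally show ?thesis
    unfolding nn_integral_g2 by (subst (asm) ennreal_le_iff) auto
qed

lemma has_integral_exp_minus:
  fixes c :: real
  assumes "u \<le> v" "0 < c"
  shows "((\<lambda>y. exp (- y / c)) has_integral c * (exp (- u / c) - exp (- v / c))) {u..v}"
proof -
  have "((\<lambda>y. exp (- y / c)) has_integral (- c * exp (- v / c) - - c * exp (- u / c))) {u..v}"
    using assms
    by (intro fundamental_theorem_of_calculus)
      (auto intro!: derivative_eq_intros simp: has_real_derivative_iff_has_vector_derivative[symmetric])
  then show ?thesis by (simp add: algebra_simps)
qed

lemma integral_g2_le_exp:
  assumes "0 < u" "u \<le> v"
  shows "integral {u..v} g2 \<le> 2 * exp (- u / 2)"
proof -
  have "integral {u..v} g2 \<le> 2 * (exp (- u / 2) - exp (- v / 2))"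
    using has_integral_exp_minus[OF assms(2), of 2] assms
    by (intro has_integral_le[OF integrable_integral[OF g2_integrable_on]]) (use g2_le in auto)
  also have "\<dots> \<le> 2 * exp (- u / 2)" by simp
  finally show ?thesis .
qed

text \<open>The total minus the part below \<open>u\<close>, where \<open>g2 y\<close> is at least
  \<open>exp (- y)\<close>. The part starts at \<open>e > 0\<close>, followed by a limit, because
  the integrability and continuity facts for \<open>g2\<close> stay away from 0.\<close>

lemma integral_g2_le_tail:
  assumes "0 < u" "u \<le> v"
  shows "integral {u..v} g2 \<le> 2 * ln 2 - (1 - exp (- u))"
proof -
  have *: "integral {u..v} g2 \<le> 2 * ln 2 - (exp (- e) - exp (- u))" if "0 < e" "e < u" for e
  proof -
    have "exp (- e) - exp (- u) \<le> integral {e..u} g2"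
      using has_integral_exp_minus[of e u 1] that
      by (intro has_integral_le[OF _ integrable_integral[OF g2_integrable_on]]) (auto intro!: g2_ge)
    moreover have "integral {e..u} g2 + integral {u..v} g2 = integral {e..v} g2"
      using that assms by (intro Henstock_Kurzweil_Integration.integral_combine g2_integrable_on) auto
    ultimately show ?thesis using integral_g2_le_total[OF that(1), of v] by simp
  qed
  have "((\<lambda>e. 2 * ln 2 - (exp (- e) - exp (- u))) \<longlongrightarrow> 2 * ln 2 - (exp (- 0) - exp (- u))) (at_right 0)"
    by (intro tendsto_intros)
  then have "integral {u..v} g2 \<le> 2 * ln 2 - (exp (- 0) - exp (- u))"
    by (rule tendsto_lowerbound)
      (auto simp: eventually_at_right_field intro!: exI[of _ u] * assms)
  then show ?thesis by simp
qed

section \<open>The capacity of the binary-input channel\<close>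

lemma ln_one_plus_sq_le:
  fixes t :: real
  assumes "0 \<le> t"
  shows "ln (1 + t\<^sup>2) \<le> t"
proof -
  have "0 - ln (1 + 0\<^sup>2) \<le> t - ln (1 + t\<^sup>2)"
  proof (rule DERIV_nonneg_imp_nondecreasing[OF assms])
    fix x :: real
    have p: "0 < 1 + x\<^sup>2" by (simp add: add_pos_nonneg)
    have "((\<lambda>t. t - ln (1 + t\<^sup>2)) has_real_derivative (1 - 2 * x / (1 + x\<^sup>2))) (at x)"
      using p by (auto intro!: derivative_eq_intros)
    moreover have "0 \<le> 1 - 2 * x / (1 + x\<^sup>2)"
      using p sum_squares_bound[of x 1] by (simp add: field_simps)
    ultimately show "\<exists>D. ((\<lambda>t. t - ln (1 + t\<^sup>2)) has_real_derivative D) (at x) \<and> 0 \<le> D" by blast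
  qed
  then show ?thesis by simp
qed

text \<open>After the tilt the integrand is \<open>exp w * ln (1 + exp (- 2 * w))\<close>, and
  \<open>ln_one_plus_sq_le\<close> at \<open>exp (- w)\<close> bounds it by 1. The whole decay thus
  comes from the tilting factor.\<close>

lemma expectation_softplus_le:
  assumes "0 \<le> \<gamma>"
  shows "(\<integral>\<xi>. ln (1 + exp (- 2 * (\<gamma> + \<xi> * sqrt \<gamma>))) \<partial>std_normal_distribution) \<le> exp (- \<gamma> / 2)"
proof -
  interpret real_distribution std_normal_distribution by (rule real_dist_normal_dist)
  let ?h = "\<lambda>w::real. exp w * ln (1 + exp (- 2 * w))"
  have m: "?h \<in> borel_measurable borel" by measurable
  have h0: "0 \<le> ?h w" for w by simp
  have h1: "?h w \<le> 1" for w
  proof -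
    have "ln (1 + exp (- 2 * w)) = ln (1 + (exp (- w))\<^sup>2)"
      by (simp add: exp_double[symmetric])
    then have "?h w \<le> exp w * exp (- w)"
      using ln_one_plus_sq_le[of "exp (- w)"] by (intro mult_left_mono) simp_all
    then show ?thesis by (simp add: exp_add[symmetric])
  qed
  have "integrable std_normal_distribution (\<lambda>t. ?h (sqrt \<gamma> * t))"
    by (rule integrable_std_normal_bounded[where B = 1]) (use m h0 h1 in \<open>measurable, simp only: abs_of_nonneg\<close>)
  then have "(\<integral>t. ?h (sqrt \<gamma> * t) \<partial>std_normal_distribution) \<le> (\<integral>t. 1 \<partial>std_normal_distribution)"
    using h1 by (intro integral_mono) auto
  then have "(\<integral>t. ?h (sqrt \<gamma> * t) \<partial>std_normal_distribution) \<le> 1"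
    using prob_space by simp
  moreover have "(\<integral>\<xi>. ln (1 + exp (- 2 * (\<gamma> + \<xi> * sqrt \<gamma>))) \<partial>std_normal_distribution)
      = exp (- \<gamma> / 2) * (\<integral>t. ?h (sqrt \<gamma> * t) \<partial>std_normal_distribution)"
    by (rule std_normal_tilt[where f = "\<lambda>y. ln (1 + exp (- 2 * y))"]) (use assms in auto)
  ultimately show ?thesis
    using mult_left_mono[of _ 1 "exp (- \<gamma> / 2)"] by simp
qed

lemma integrable_softplus:
  "integrable std_normal_distribution (\<lambda>\<xi>. ln (1 + exp (- 2 * (\<gamma> + \<xi> * c))))"
proof -
  interpret real_distribution std_normal_distribution by (rule real_dist_normal_dist)
  have "integrable std_normal_distribution (\<lambda>\<xi>. \<xi>\<^sup>2)"
    by (rule std_normal_second_moment)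
  then have "integrable std_normal_distribution (\<lambda>\<xi>. ln 2 + 2 * \<bar>\<gamma>\<bar> + 2 * \<bar>c\<bar> * (1 + \<xi>\<^sup>2))"
    by simp
  then show ?thesis
  proof (rule Bochner_Integration.integrable_bound)
    show "AE \<xi> in std_normal_distribution. norm (ln (1 + exp (- 2 * (\<gamma> + \<xi> * c))))
        \<le> norm (ln 2 + 2 * \<bar>\<gamma>\<bar> + 2 * \<bar>c\<bar> * (1 + \<xi>\<^sup>2))"
    proof (intro AE_I2)
      fix \<xi> :: real
      let ?y = "- 2 * (\<gamma> + \<xi> * c)"
      have "1 + exp ?y \<le> 2 * exp \<bar>?y\<bar>"
        using exp_le_cancel_iff[of ?y "\<bar>?y\<bar>"] one_le_exp_iff[of "\<bar>?y\<bar>"] by linarith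
      then have "ln (1 + exp ?y) \<le> ln (2 * exp \<bar>?y\<bar>)"
        by (subst ln_le_cancel_iff) (auto simp: add_pos_pos)
      also have "\<dots> = ln 2 + \<bar>?y\<bar>" by (simp add: ln_mult)
      also have "\<bar>?y\<bar> \<le> 2 * \<bar>\<gamma>\<bar> + 2 * (\<bar>c\<bar> * \<bar>\<xi>\<bar>)"
        using abs_triangle_ineq[of \<gamma> "\<xi> * c"] by (simp add: abs_mult mult.commute)
      also have "\<bar>\<xi>\<bar> \<le> 1 + \<xi>\<^sup>2"
        using sum_squares_bound[of "\<bar>\<xi>\<bar>" 1] by (simp add: power2_eq_square abs_if split: if_splits)
      finally have "ln (1 + exp ?y) \<le> ln 2 + 2 * \<bar>\<gamma>\<bar> + 2 * \<bar>c\<bar> * (1 + \<xi>\<^sup>2)"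
        by (simp add: mult_left_mono)
      moreover have "0 \<le> ln (1 + exp ?y)" by simp
      ultimately show "norm (ln (1 + exp ?y)) \<le> norm (ln 2 + 2 * \<bar>\<gamma>\<bar> + 2 * \<bar>c\<bar> * (1 + \<xi>\<^sup>2))"
        by simp
    qed
  qed simp
qed

section \<open>Joint law and mutual information of the binary-input channel\<close>

lemma measurable_count_space_pair:
  fixes f :: "'a::topological_space \<times> 'b::topological_space \<Rightarrow> 'c"
  assumes "f \<in> (borel \<Otimes>\<^sub>M borel) \<rightarrow>\<^sub>M N"
  shows "f \<in> (count_space A \<Otimes>\<^sub>M borel) \<rightarrow>\<^sub>M N"
proof -
  \<comment> \<open>Every map out of \<open>count_space A\<close> into a Borel space is measurable,
    so the identity into the Borel product is, and measurability can be proved there.\<close>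
  have "(\<lambda>w. (fst w, snd w)) \<in> (count_space A \<Otimes>\<^sub>M (borel :: 'b measure)) \<rightarrow>\<^sub>M ((borel :: 'a measure) \<Otimes>\<^sub>M borel)"
    by (intro measurable_Pair measurable_snd measurable_compose[OF measurable_fst]) simp
  from measurable_compose[OF this assms] show ?thesis by simp
qed

lemma prob_space_biawgn: "prob_space biawgn_space"
  and sets_biawgn: "sets biawgn_space = sets (count_space {-1, 1} \<Otimes>\<^sub>M borel)"
  and space_biawgn: "space biawgn_space = {-1, 1} \<times> UNIV"
proof -
  interpret N: prob_space std_normal_distribution
    using real_dist_normal_dist by (simp add: real_distribution_def)
  interpret U: prob_space "uniform_count_measure {-1, 1::real}"
    by (rule prob_space_uniform_count_measure) auto
  interpret pair_prob_space "uniform_count_measure {-1, 1::real}" std_normal_distribution ..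
  show "prob_space biawgn_space"
    unfolding biawgn_space_def by (rule prob_space_axioms)
  show "sets biawgn_space = sets (count_space {-1, 1} \<Otimes>\<^sub>M borel)"
    unfolding biawgn_space_def
    by (intro sets_pair_measure_cong) (simp_all add: sets_uniform_count_measure)
  show "space biawgn_space = {-1, 1} \<times> UNIV"
    unfolding biawgn_space_def by (simp add: space_pair_measure space_uniform_count_measure)
qed

lemma nn_integral_biawgn:
  assumes [measurable]: "f \<in> borel_measurable (count_space {-1, 1} \<Otimes>\<^sub>M borel)"
  shows "(\<integral>\<^sup>+\<omega>. f \<omega> \<partial>biawgn_space) =
    (\<integral>\<^sup>+x. \<integral>\<^sup>+z. ennreal (1 / 2 * std_normal_density z) * f (x, z) \<partial>lborel \<partial>count_space {-1, 1})"
proof -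
  interpret N: prob_space std_normal_distribution
    using real_dist_normal_dist by (simp add: real_distribution_def)
  have m: "f \<in> borel_measurable (uniform_count_measure {-1, 1::real} \<Otimes>\<^sub>M std_normal_distribution)"
    using assms sets_biawgn unfolding biawgn_space_def by (simp cong: measurable_cong_sets)
  have mx: "(\<lambda>z. f (x, z)) \<in> borel_measurable borel" if "x \<in> {-1, 1}" for x
    using that by (intro measurable_compose[OF measurable_Pair1' assms]) simp
  have "(\<integral>\<^sup>+\<omega>. f \<omega> \<partial>biawgn_space) =
      (\<integral>\<^sup>+x. \<integral>\<^sup>+z. f (x, z) \<partial>std_normal_distribution \<partial>uniform_count_measure {-1, 1})"
    unfolding biawgn_space_def by (rule N.nn_integral_fst[OF m, symmetric])
  also have "\<dots> = (\<integral>\<^sup>+x. ennreal (1 / 2) * (\<integral>\<^sup>+z. f (x, z) \<partial>std_normal_distribution) \<partial>count_space {-1, 1})"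
    by (simp add: uniform_count_measure_def point_measure_def nn_integral_density)
  also have "\<dots> = (\<integral>\<^sup>+x. \<integral>\<^sup>+z. ennreal (1 / 2 * std_normal_density z) * f (x, z) \<partial>lborel \<partial>count_space {-1, 1})"
  proof (rule nn_integral_cong)
    fix x :: real assume "x \<in> space (count_space {-1, 1})"
    then have [measurable]: "(\<lambda>z. f (x, z)) \<in> borel_measurable borel" using mx by simp
    have "ennreal (1 / 2) * (\<integral>\<^sup>+z. f (x, z) \<partial>std_normal_distribution)
        = (\<integral>\<^sup>+z. ennreal (1 / 2) * (ennreal (std_normal_density z) * f (x, z)) \<partial>lborel)"
      by (simp add: nn_integral_density nn_integral_cmult)
    also have "\<dots> = (\<integral>\<^sup>+z. ennreal (1 / 2 * std_normal_density z) * f (x, z) \<partial>lborel)"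
      by (simp only: mult.assoc[symmetric] ennreal_mult[symmetric] normal_density_nonneg zero_le_divide_1_iff
          zero_le_numeral)
    finally show "ennreal (1 / 2) * (\<integral>\<^sup>+z. f (x, z) \<partial>std_normal_distribution)
        = (\<integral>\<^sup>+z. ennreal (1 / 2 * std_normal_density z) * f (x, z) \<partial>lborel)" .
  qed
  finally show ?thesis .
qed

text \<open>For a fixed input \<open>x\<close> the output is the noise translated by
  \<open>r * x\<close>; the equality of measures reduces to this substitution in the inner
  integral.\<close>

lemma distributed_biawgn:
  "distributed biawgn_space (count_space {-1, 1} \<Otimes>\<^sub>M lborel)
     (\<lambda>\<omega>. ((\<lambda>(X, Z). X) \<omega>, (\<lambda>(X, Z). r * X + Z) \<omega>))
     (\<lambda>(x, y). ennreal (1 / 2 * std_normal_density (y - r * x)))"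
  unfolding distributed_def
proof (intro conjI measure_eqI)
  let ?S = "count_space {-1, 1::real}"
  let ?T = "\<lambda>\<omega>. ((\<lambda>(X, Z). X) \<omega>, (\<lambda>(X, Z). r * X + Z) \<omega>)"
  let ?P = "\<lambda>(x, y). ennreal (1 / 2 * std_normal_density (y - r * x))"
  have T0: "?T \<in> (?S \<Otimes>\<^sub>M borel) \<rightarrow>\<^sub>M (?S \<Otimes>\<^sub>M lborel)"
  proof (rule measurable_Pair)
    have "(\<lambda>(X, Z). r * X + Z) \<in> borel_measurable (?S \<Otimes>\<^sub>M borel)"
      by (rule measurable_count_space_pair) measurable
    then show "(\<lambda>(X, Z). r * X + Z) \<in> (?S \<Otimes>\<^sub>M borel) \<rightarrow>\<^sub>M lborel"
      by simp
    show "(\<lambda>(X, Z). X) \<in> (?S \<Otimes>\<^sub>M borel) \<rightarrow>\<^sub>M ?S"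
      by (simp add: case_prod_beta')
  qed
  then show T: "?T \<in> biawgn_space \<rightarrow>\<^sub>M (?S \<Otimes>\<^sub>M lborel)"
    by (subst measurable_cong_sets[OF sets_biawgn refl])
  show P [measurable]: "?P \<in> borel_measurable (?S \<Otimes>\<^sub>M lborel)"
    by (subst measurable_cong_sets[OF sets_pair_measure_cong[OF refl sets_lborel] refl],
        rule measurable_count_space_pair) measurable
  fix A assume "A \<in> sets (distr biawgn_space (?S \<Otimes>\<^sub>M lborel) ?T)"
  then have A [measurable]: "A \<in> sets (?S \<Otimes>\<^sub>M lborel)" by simp
  have "emeasure (distr biawgn_space (?S \<Otimes>\<^sub>M lborel) ?T) A = (\<integral>\<^sup>+w. indicator A w \<partial>distr biawgn_space (?S \<Otimes>\<^sub>M lborel) ?T)"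
    by simp
  also have "\<dots> = (\<integral>\<^sup>+\<omega>. indicator A (?T \<omega>) \<partial>biawgn_space)"
    by (rule nn_integral_distr[OF T]) measurable
  also have "\<dots> = (\<integral>\<^sup>+x. \<integral>\<^sup>+z. ennreal (1 / 2 * std_normal_density z) * indicator A (?T (x, z)) \<partial>lborel \<partial>?S)"
    by (rule nn_integral_biawgn) (rule measurable_compose[OF T0 borel_measurable_indicator[OF A]])
  also have "\<dots> = (\<integral>\<^sup>+x. \<integral>\<^sup>+y. ?P (x, y) * indicator A (x, y) \<partial>lborel \<partial>?S)"
  proof (rule nn_integral_cong)
    fix x :: real assume "x \<in> space ?S"
    then have x: "x \<in> {-1, 1}" by simp
    have [measurable]: "(\<lambda>y. indicator A (x, y) :: ennreal) \<in> borel_measurable borel"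
      using measurable_compose[OF measurable_Pair1' borel_measurable_indicator[OF A], of x] x by simp
    have "(\<integral>\<^sup>+y. ?P (x, y) * indicator A (x, y) \<partial>lborel) =
        ennreal \<bar>1\<bar> * (\<integral>\<^sup>+z. ?P (x, r * x + 1 * z) * indicator A (x, r * x + 1 * z) \<partial>lborel)"
      by (rule nn_integral_real_affine) auto
    then show "(\<integral>\<^sup>+z. ennreal (1 / 2 * std_normal_density z) * indicator A (?T (x, z)) \<partial>lborel) =
        (\<integral>\<^sup>+y. ?P (x, y) * indicator A (x, y) \<partial>lborel)"
      by simp
  qed
  also have "\<dots> = (\<integral>\<^sup>+w. ?P w * indicator A w \<partial>(?S \<Otimes>\<^sub>M lborel))"
    by (rule lborel.nn_integral_fst) measurable
  also have "\<dots> = emeasure (density (?S \<Otimes>\<^sub>M lborel) ?P) A"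
    by (rule emeasure_density[symmetric]) measurable
  finally show "emeasure (distr biawgn_space (?S \<Otimes>\<^sub>M lborel) ?T) A = emeasure (density (?S \<Otimes>\<^sub>M lborel) ?P) A" .
qed simp

lemma nn_integral_normal_density_shift: "(\<integral>\<^sup>+y. ennreal (std_normal_density (y - c)) \<partial>lborel) = 1"
proof -
  interpret N: prob_space std_normal_distribution
    using real_dist_normal_dist by (simp add: real_distribution_def)
  have "(\<integral>\<^sup>+y. ennreal (std_normal_density (y - c)) \<partial>lborel) = ennreal \<bar>1\<bar> * (\<integral>\<^sup>+y. ennreal (std_normal_density (c + 1 * y - c)) \<partial>lborel)"
    by (rule nn_integral_real_affine) auto
  also have "\<dots> = emeasure std_normal_distribution (space std_normal_distribution)"
    by (subst emeasure_density) auto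
  finally show ?thesis using N.emeasure_space_1 by simp
qed

text \<open>The integrand is the information density at the transmitted pair. The likelihood of the
  wrong input relative to the right one is
  \<open>exp (- 2 * (\<gamma> + z * x * sqrt \<gamma>))\<close>, so one bit is lost up to a softplus
  term.\<close>

lemma capacity_biawgn_eq:
  assumes "0 \<le> \<gamma>"
  shows "capacity_biawgn \<gamma> =
    (\<integral>\<omega>. 1 - ln (1 + exp (- 2 * (\<gamma> + snd \<omega> * (fst \<omega> * sqrt \<gamma>)))) / ln 2 \<partial>biawgn_space)"
proof -
  define r where "r = sqrt \<gamma>"
  have r2: "r * r = \<gamma>" using assms by (simp add: r_def)
  let ?S = "count_space {-1, 1::real}"
  let ?X = "\<lambda>(X, Z). X" and ?Y = "\<lambda>(X, Z). r * X + Z"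
  let ?T = "\<lambda>\<omega>. (?X \<omega>, ?Y \<omega>)"
  let ?P = "\<lambda>(x, y). 1 / 2 * std_normal_density (y - r * x)"
  let ?Q = "\<lambda>y. 1 / 2 * std_normal_density (y + r) + 1 / 2 * std_normal_density (y - r)"
  interpret prob_space biawgn_space by (rule prob_space_biawgn)
  interpret information_space biawgn_space 2 by standard simp
  have S: "sigma_finite_measure ?S" by (simp add: sigma_finite_measure_count_space_finite)
  have D: "distributed biawgn_space (?S \<Otimes>\<^sub>M lborel) ?T (\<lambda>w. ennreal (?P w))"
    using distributed_biawgn[of r] by (simp only: case_prod_beta case_prod_beta')
  have "distributed biawgn_space ?S ?X (\<lambda>x. \<integral>\<^sup>+y. ennreal (?P (x, y)) \<partial>lborel)"
    by (rule distr_marginal1[OF S sigma_finite_lborel D])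
  moreover have "(\<integral>\<^sup>+y. ennreal (?P (x, y)) \<partial>lborel) = ennreal (1 / 2)" for x
  proof -
    have "(\<integral>\<^sup>+y. ennreal (?P (x, y)) \<partial>lborel) = (\<integral>\<^sup>+y. ennreal (1 / 2) * ennreal (std_normal_density (y - r * x)) \<partial>lborel)"
      by (intro nn_integral_cong) (simp only: prod.case ennreal_mult'[symmetric] zero_le_divide_1_iff zero_le_numeral)
    also have "\<dots> = ennreal (1 / 2)"
      by (subst nn_integral_cmult) (auto simp: nn_integral_normal_density_shift)
    finally show ?thesis .
  qed
  ultimately have DX: "distributed biawgn_space ?S ?X (\<lambda>x. ennreal (1 / 2))"
    by simp
  have "distributed biawgn_space lborel ?Y (\<lambda>y. \<integral>\<^sup>+x. ennreal (?P (x, y)) \<partial>?S)"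
    by (rule distr_marginal2[OF S sigma_finite_lborel D])
  moreover have "(\<integral>\<^sup>+x. ennreal (?P (x, y)) \<partial>?S) = ennreal (?Q y)" for y
    by (subst nn_integral_count_space_finite) (auto simp: ennreal_plus[symmetric] simp del: ennreal_plus)
  ultimately have DY: "distributed biawgn_space lborel ?Y (\<lambda>y. ennreal (?Q y))"
    by simp
  have Pm: "?P \<in> borel_measurable (?S \<Otimes>\<^sub>M lborel)"
    by (subst measurable_cong_sets[OF sets_pair_measure_cong[OF refl sets_lborel] refl],
        rule measurable_count_space_pair) measurable
  let ?h = "\<lambda>w. log 2 (?P w / (1 / 2 * ?Q (snd w)))"
  have hm [measurable]: "?h \<in> borel_measurable (?S \<Otimes>\<^sub>M lborel)"
    by (subst measurable_cong_sets[OF sets_pair_measure_cong[OF refl sets_lborel] refl],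
        rule measurable_count_space_pair) measurable
  \<comment> \<open>The definition takes \<open>borel\<close> as output space, while densities refer
    to \<open>lborel\<close>; image measures see only the common sigma-algebra.\<close>
  have "distr biawgn_space borel ?Y = distr biawgn_space lborel ?Y"
    by (intro distr_cong) simp_all
  moreover have "distr biawgn_space (?S \<Otimes>\<^sub>M borel) ?T = distr biawgn_space (?S \<Otimes>\<^sub>M lborel) ?T"
    by (intro distr_cong refl sets_pair_measure_cong) simp_all
  ultimately have "capacity_biawgn \<gamma> = mutual_information 2 ?S lborel ?X ?Y"
    unfolding capacity_biawgn_def mutual_information_def r_def[symmetric] by simp
  also have "\<dots> = (\<integral>w. ?P w * ?h w \<partial>(?S \<Otimes>\<^sub>M lborel))"
    by (subst mutual_information_distr[OF S sigma_finite_lborel DX _ DY _ D]) auto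
  also have "\<dots> = (\<integral>w. ?h w \<partial>density (?S \<Otimes>\<^sub>M lborel) (\<lambda>w. ennreal (?P w)))"
    by (subst integral_density[OF hm Pm]) (simp_all add: case_prod_beta)
  also have "\<dots> = (\<integral>w. ?h w \<partial>distr biawgn_space (?S \<Otimes>\<^sub>M lborel) ?T)"
    by (simp only: distributed_distr_eq_density[OF D])
  also have "\<dots> = (\<integral>\<omega>. ?h (?T \<omega>) \<partial>biawgn_space)"
    by (rule integral_distr[OF distributed_measurable[OF D] hm])
  also have "\<dots> = (\<integral>\<omega>. 1 - ln (1 + exp (- 2 * (\<gamma> + snd \<omega> * (fst \<omega> * r)))) / ln 2 \<partial>biawgn_space)"
  proof (intro Bochner_Integration.integral_cong refl)
    fix \<omega> assume "\<omega> \<in> space biawgn_space"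
    then obtain x z where w: "\<omega> = (x, z)" and x: "x = -1 \<or> x = 1"
      by (auto simp: space_biawgn)
    let ?e = "exp (- 2 * (\<gamma> + z * (x * r)))"
    have tilt: "std_normal_density (z + 2 * (r * x)) = std_normal_density z * ?e"
    proof -
      have "- (z + 2 * (r * x))\<^sup>2 / 2 = - z\<^sup>2 / 2 + - 2 * (\<gamma> + z * (x * r))"
        using x r2 by (auto simp: power2_eq_square field_simps)
      then show ?thesis unfolding std_normal_density_def by (simp add: exp_add[symmetric])
    qed
    have "?Q (r * x + z) = 1 / 2 * (std_normal_density z + std_normal_density (z + 2 * (r * x)))"
      using x by (auto simp: add.commute[of _ z])
    then have Q: "?Q (r * x + z) = 1 / 2 * (std_normal_density z * (1 + ?e))"
      by (simp only: tilt distrib_left[of "std_normal_density z"] mult_1_right)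
    have e: "std_normal_density z \<noteq> 0" "1 + ?e > 0"
      using normal_density_pos[of 1 0 z] by (simp_all add: add_pos_pos)
    have "?h (?T \<omega>) = log 2 (1 / 2 * std_normal_density z / (1 / 2 * (1 / 2 * (std_normal_density z * (1 + ?e)))))"
      unfolding w Q[symmetric] by simp
    also have "1 / 2 * std_normal_density z / (1 / 2 * (1 / 2 * (std_normal_density z * (1 + ?e)))) = 2 / (1 + ?e)"
      using e(1) by simp
    also have "log 2 (2 / (1 + ?e)) = 1 - ln (1 + ?e) / ln 2"
      using e(2) by (subst log_divide) (auto simp: log_def)
    finally show "?h (?T \<omega>) = 1 - ln (1 + exp (- 2 * (\<gamma> + snd \<omega> * (fst \<omega> * r)))) / ln 2"
      by (simp add: w)
  qed
  finally show ?thesis by (simp add: r_def)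
qed

text \<open>The noise is symmetric, so both inputs suffer the same expected softplus loss. The
  nonnegative integral is bounded before anything else because its finiteness gives the
  integrability needed to split off the 1.\<close>

lemma capacity_biawgn_ge:
  assumes "0 \<le> \<gamma>"
  shows "1 - exp (- \<gamma> / 2) / ln 2 \<le> capacity_biawgn \<gamma>"
proof -
  interpret prob_space biawgn_space by (rule prob_space_biawgn)
  let ?l = "\<lambda>x z. ln (1 + exp (- 2 * (\<gamma> + z * (x * sqrt \<gamma>))))"
  let ?g = "\<lambda>\<omega>. ?l (fst \<omega>) (snd \<omega>) / ln 2"
  have gm0 [measurable]: "?g \<in> borel_measurable (count_space {-1, 1} \<Otimes>\<^sub>M borel)"
    by (rule measurable_count_space_pair) measurable
  have gm: "?g \<in> borel_measurable biawgn_space"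
    using gm0 sets_biawgn by (simp cong: measurable_cong_sets)
  have mean: "(\<integral>z. ?l x z \<partial>std_normal_distribution) \<le> exp (- \<gamma> / 2)" if "x \<in> {-1, 1}" for x
    using that expectation_softplus_le[OF assms]
      integral_std_normal_uminus[of "\<lambda>z. ln (1 + exp (- 2 * (\<gamma> + z * sqrt \<gamma>)))"] by auto
  have "(\<integral>\<^sup>+\<omega>. ennreal (?g \<omega>) \<partial>biawgn_space) =
      (\<integral>\<^sup>+x. \<integral>\<^sup>+z. ennreal (1 / 2 * std_normal_density z) * ennreal (?g (x, z)) \<partial>lborel \<partial>count_space {-1, 1})"
    by (rule nn_integral_biawgn) measurable
  also have "\<dots> \<le> (\<integral>\<^sup>+x. ennreal (exp (- \<gamma> / 2) / ln 2 / 2) \<partial>count_space {-1, 1::real})"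
  proof (rule nn_integral_mono)
    fix x :: real assume "x \<in> space (count_space {-1, 1})"
    then have x: "x \<in> {-1, 1}" by simp
    have "(\<integral>\<^sup>+z. ennreal (1 / 2 * std_normal_density z) * ennreal (?g (x, z)) \<partial>lborel) =
        (\<integral>\<^sup>+z. ennreal (std_normal_density z) * ennreal (?l x z * (1 / (2 * ln 2))) \<partial>lborel)"
      by (intro nn_integral_cong) (simp add: ennreal_mult'[symmetric])
    also have "\<dots> = (\<integral>\<^sup>+z. ennreal (?l x z * (1 / (2 * ln 2))) \<partial>std_normal_distribution)"
      by (subst nn_integral_density) auto
    also have "\<dots> = ennreal (\<integral>z. ?l x z * (1 / (2 * ln 2)) \<partial>std_normal_distribution)"
      by (rule nn_integral_eq_integral[OF integrable_mult_left[OF integrable_softplus]]) simp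
    also have "(\<integral>z. ?l x z * (1 / (2 * ln 2)) \<partial>std_normal_distribution) = (\<integral>z. ?l x z \<partial>std_normal_distribution) * (1 / (2 * ln 2))"
      by (rule integral_mult_left_zero)
    also have "ennreal \<dots> \<le> ennreal (exp (- \<gamma> / 2) * (1 / (2 * ln 2)))"
      by (intro ennreal_leI mult_right_mono mean x) simp
    finally show "(\<integral>\<^sup>+z. ennreal (1 / 2 * std_normal_density z) * ennreal (?g (x, z)) \<partial>lborel) \<le> ennreal (exp (- \<gamma> / 2) / ln 2 / 2)"
      by (simp add: mult.commute)
  qed
  also have "\<dots> = ennreal (exp (- \<gamma> / 2) / ln 2)"
    by (subst nn_integral_count_space_finite)
      (auto simp: ennreal_mult'[symmetric] ennreal_numeral[symmetric] simp del: ennreal_numeral)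
  finally have le: "(\<integral>\<^sup>+\<omega>. ennreal (?g \<omega>) \<partial>biawgn_space) \<le> ennreal (exp (- \<gamma> / 2) / ln 2)" .
  have int: "integrable biawgn_space ?g"
    by (rule integrableI_nonneg[OF gm]) (use le in \<open>auto simp: le_less_trans\<close>)
  have "ennreal (\<integral>\<omega>. ?g \<omega> \<partial>biawgn_space) \<le> ennreal (exp (- \<gamma> / 2) / ln 2)"
    using le by (subst nn_integral_eq_integral[symmetric, OF int]) auto
  then have "(\<integral>\<omega>. ?g \<omega> \<partial>biawgn_space) \<le> exp (- \<gamma> / 2) / ln 2"
    by (subst (asm) ennreal_le_iff) auto
  moreover have "capacity_biawgn \<gamma> = 1 - (\<integral>\<omega>. ?g \<omega> \<partial>biawgn_space)"
    unfolding capacity_biawgn_eq[OF assms] using int prob_space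
    by (subst Bochner_Integration.integral_diff) auto
  ultimately show ?thesis by simp
qed

section \<open>Numerical estimates\<close>

lemma exp_ge_taylor:
  fixes x :: real
  assumes "0 \<le> x"
  shows "1 + x + x ^ 2 / 2 + x ^ 3 / 6 + x ^ 4 / 24 + x ^ 5 / 120 + x ^ 6 / 720 \<le> exp x"
proof -
  have "(\<Sum>n<7. inverse (fact n) *\<^sub>R x ^ n) \<le> (\<Sum>n. inverse (fact n) *\<^sub>R x ^ n)"
    using assms by (intro sum_le_suminf summable_exp_generic) auto
  then show ?thesis
    by (simp add: exp_def lessThan_nat_numeral lessThan_Suc fact_numeral eval_nat_numeral field_simps)
qed

text \<open>Argument reduction: at \<open>x / 8\<close> six Taylor terms are accurate enough for the
  constants below, and the eighth power restores \<open>x\<close>.\<close>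

lemma exp_ge_taylor_eighth:
  fixes x :: real
  assumes "0 \<le> x" and h: "h = x / 8"
  shows "(1 + h + h ^ 2 / 2 + h ^ 3 / 6 + h ^ 4 / 24 + h ^ 5 / 120 + h ^ 6 / 720) ^ 8 \<le> exp x"
proof -
  have "0 \<le> h" using assms by simp
  then have "(1 + h + h ^ 2 / 2 + h ^ 3 / 6 + h ^ 4 / 24 + h ^ 5 / 120 + h ^ 6 / 720) ^ 8 \<le> exp h ^ 8"
    by (intro power_mono exp_ge_taylor) (auto intro!: add_nonneg_nonneg)
  also have "exp h ^ 8 = exp x"
    by (simp add: h exp_of_nat_mult[symmetric])
  finally show ?thesis .
qed

lemma exp_minus_leI: "0 < c \<Longrightarrow> 1 / c \<le> exp x \<Longrightarrow> exp (- x) \<le> (c::real)"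
  by (simp add: exp_minus field_simps)

text \<open>The left sides are the products whose logarithms occur later, rounded up where
  necessary: \<open>7 / 2 * q\<close> for \<open>q\<close> equal to 4, 3.3, 2.5, then
  \<open>q * 0.7216 * 5.2\<close> for \<open>q\<close> equal to 6, 10 and \<open>3.1 * 5.2\<close>.
  The last two serve \<open>exp_ge_large\<close>.\<close>

lemma exp_lower_numeric:
  "14 \<le> exp (2.64::real)" "11.55 \<le> exp (2.45::real)" "8.75 \<le> exp (2.17::real)"
  "22.515 \<le> exp (3.115::real)" "37.524 \<le> exp (3.626::real)" "60.489 \<le> exp (4.103::real)"
  "17.4 \<le> exp (2.86::real)" "181 \<le> exp (5.2::real)"
  by (rule order_trans[OF _ exp_ge_taylor_eighth[OF _ refl]], simp add: power_divide, simp)+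

lemma exp_upper_numeric:
  "exp (- 1.8) \<le> (0.1654::real)" "exp (- 2.5) \<le> (0.0821::real)" "exp (- 3.3) \<le> (0.0369::real)"
  "exp (- 2) \<le> (0.13535::real)" "exp (- 3) \<le> (0.0498::real)" "exp (- 5) \<le> (0.00674::real)"
  by (rule exp_minus_leI, simp, rule order_trans[OF _ exp_ge_taylor_eighth[OF _ refl]], simp add: power_divide, simp)+

lemma ln2_bounds: "0.693 \<le> ln (2::real)" "ln (2::real) \<le> 0.6932"
  using ln_approx_bounds[of 2 3] by (simp_all add: eval_nat_numeral)

section \<open>Inequalities for the small and the middle range of \<open>u\<close>\<close>

lemma ln_le_tangent:
  fixes x y :: real
  assumes "0 < x" "0 < y" "y \<le> exp L"
  shows "ln x \<le> L + x / y - 1"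
proof -
  have "ln (x / y) \<le> x / y - 1"
    using assms by (intro ln_le_minus_one) simp
  moreover have "ln y \<le> L"
    using assms ln_le_cancel_iff[of y "exp L"] by simp
  ultimately show ?thesis using assms by (simp add: ln_divide_pos)
qed

text \<open>On \<open>{p..q}\<close> the variable \<open>u\<close> is replaced by the worse endpoint
  in each term. The logarithm is then bounded by its tangent at \<open>a = 7 / 2\<close>, leaving an
  inequality linear in \<open>a\<close>. Its slope has the right sign as
  \<open>e \<le> 1 / 2\<close>, so the value at \<open>7 / 2\<close>, which is the numerical
  hypothesis, decides.\<close>

lemma ln_exp_bound_piece:
  fixes a u :: real
  assumes a: "7 / 2 \<le> a" and u: "0 < u" "p \<le> u" "u \<le> q"
    and "7 / 2 * q \<le> exp L" "exp (- p) \<le> e" "L + 5 / 7 \<le> 7 / 2 * (1 - e)" "e \<le> 1 / 2"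
  shows "- 1 / a \<le> - ln (a * u) - 1 + a * (1 - exp (- u))"
proof -
  have "ln (a * u) \<le> ln (a * q)"
    using a u by (subst ln_le_cancel_iff) auto
  also have "\<dots> \<le> L + a * q / (7 / 2 * q) - 1"
    using assms by (intro ln_le_tangent) auto
  also have "a * q / (7 / 2 * q) = a * (2 / 7)"
    using u by simp
  finally have l: "ln (a * u) \<le> L + a * (2 / 7) - 1" .
  have "exp (- u) \<le> e"
    using u assms(6) by (meson exp_le_cancel_iff neg_le_iff_le order_trans)
  then have w: "a * (1 - e) \<le> a * (1 - exp (- u))"
    using a by (intro mult_left_mono) auto
  \<comment> \<open>The concave function \<open>- 1 / a\<close> lies below its tangent at
    \<open>7 / 2\<close>.\<close>
  have t: "- 1 / a \<le> a * (4 / 49) - 4 / 7"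
  proof -
    have "0 \<le> (a * (2 / 7) - 1)\<^sup>2" by simp
    then show ?thesis using a by (simp add: field_simps power2_eq_square)
  qed
  have "0 \<le> (a - 7 / 2) * ((1 - e) - 2 / 7 - 4 / 49)"
    using a assms(8) by (intro mult_nonneg_nonneg) auto
  then have "7 / 2 * (1 - e - 2 / 7 - 4 / 49) \<le> a * (1 - e) - a * (2 / 7) - a * (4 / 49)"
    by (simp only: left_diff_distrib right_diff_distrib)
  moreover define X where "X = a * (1 - e)"
  ultimately have "a * (4 / 49) - 4 / 7 \<le> - (L + a * (2 / 7) - 1) - 1 + X"
    using assms(7) by simp
  with l w t show ?thesis by (simp add: X_def)
qed

text \<open>For \<open>u \<le> 2 / a\<close>, splitting \<open>ln (a * u)\<close> at \<open>w = 1 - exp (- u)\<close> leaves \<open>- ln (u / w) \<ge> - u / 2\<close>. On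
  \<open>{2 / a..1.8}\<close> the right-hand side increases, because \<open>exp y \<le> a * y\<close> holds at both ends and hence,
  by convexity, in between. Beyond, bounds that are constant on intervals suffice.\<close>

lemma ln_exp_bound:
  fixes a u :: real
  assumes a: "7 / 2 \<le> a" and u: "0 < u" "u \<le> 4"
  shows "- 1 / a \<le> - ln (a * u) - 1 + a * (1 - exp (- u))"
proof -
  let ?B = "\<lambda>u. - ln (a * u) - 1 + a * (1 - exp (- u))"
  have small: "- 1 / a \<le> ?B u" if "0 < u" "u \<le> 2 / a" for u
  proof -
    define w where "w = 1 - exp (- u)"
    have w: "0 < w" using that by (simp add: w_def)
    have "u \<le> exp (u / 2) - exp (- u / 2)"
      using real_le_x_sinh[of "u / 2"] that by (simp add: exp_minus)
    also have "\<dots> = w * exp (u / 2)"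
      by (simp add: w_def algebra_simps exp_add[symmetric])
    finally have "ln u \<le> ln (w * exp (u / 2))"
      using that w by (subst ln_le_cancel_iff) auto
    also have "\<dots> = ln w + u / 2"
      using w by (simp add: ln_mult)
    finally have "ln u \<le> ln w + u / 2" .
    moreover have "ln (a * w) \<le> a * w - 1"
      using a w by (intro ln_le_minus_one) simp
    moreover have "ln (a * w) = ln a + ln w" "ln (a * u) = ln a + ln u"
      using a w that by (simp_all add: ln_mult)
    moreover have "u / 2 \<le> 1 / a" using that a by (simp add: field_simps)
    ultimately show ?thesis by (simp add: w_def[symmetric])
  qed
  have two_a: "0 < 2 / a" "2 / a \<le> 4 / 7" using a by (auto simp: field_simps)
  consider "u \<le> 2 / a" | "2 / a \<le> u" "u \<le> 1.8" | "1.8 \<le> u" "u \<le> 2.5" | "2.5 \<le> u" "u \<le> 3.3" | "3.3 \<le> u" "u \<le> 4"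
    using u by linarith
  then show ?thesis
  proof cases
    case 1
    then show ?thesis using small u by blast
  next
    case 2
    have conv: "convex_on {2 / a..1.8} (\<lambda>y. exp y + - a * y)"
      by (intro convex_on_add convex_on_subset[OF exp_convex]) (auto intro!: convex_onI simp: algebra_simps)
    have le: "exp y \<le> a * y" if "2 / a \<le> y" "y \<le> 1.8" for y
    proof -
      have "exp (2 / a) \<le> exp (4 / 7 :: real)" using two_a by simp
      also have "\<dots> \<le> 2"
        using exp_ge_one_minus_x_over_n_power_n[of "4 / 7" 2] by (simp add: exp_minus field_simps power2_eq_square)
      finally have e1: "exp (2 / a) - a * (2 / a) \<le> 0" using a by simp
      \<comment> \<open>The breakpoint 1.8 lies slightly below the larger root of
        \<open>exp y = 7 / 2 * y\<close>, so the monotonicity argument reaches almost as far as it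
        can for \<open>a = 7 / 2\<close>.\<close>
      have e2: "exp 1.8 - a * 1.8 \<le> 0"
      proof -
        have "exp (1.8::real) = exp 1 * exp 1 * exp (- 0.2)"
          by (simp add: exp_add[symmetric])
        also have "\<dots> \<le> 2.72 * 2.72 * 0.82"
          using e_less_272 exp_minus_leI[of "0.82" "0.2"] exp_ge_taylor[of "0.2"]
          by (intro mult_mono) (auto simp: power_divide)
        finally show ?thesis using a by simp
      qed
      have "exp y + - a * y \<le> max (exp (2 / a) + - a * (2 / a)) (exp 1.8 + - a * 1.8)"
        using that by (intro convex_on_le_max[OF conv]) auto
      with e1 e2 show ?thesis by linarith
    qed
    have "?B (2 / a) \<le> ?B u"
    proof (rule DERIV_nonneg_imp_nondecreasing[OF 2(1)])
      fix y assume y: "2 / a \<le> y" "y \<le> u"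
      then have y0: "0 < y" using two_a by linarith
      have "(?B has_real_derivative (- 1 / y + a * exp (- y))) (at y)"
        using y0 a by (auto intro!: derivative_eq_intros simp: field_simps)
      moreover have "0 \<le> - 1 / y + a * exp (- y)"
        using le[of y] y 2 y0 by (simp add: exp_minus field_simps)
      ultimately show "\<exists>D. (?B has_real_derivative D) (at y) \<and> 0 \<le> D" by blast
    qed
    with small[of "2 / a"] two_a show ?thesis by linarith
  next
    case 3
    then show ?thesis using exp_lower_numeric(3) exp_upper_numeric(1) a u
      by (intro ln_exp_bound_piece[where p = "1.8" and q = "2.5" and L = "2.17" and e = "0.1654"]) auto
  next
    case 4
    then show ?thesis using exp_lower_numeric(2) exp_upper_numeric(2) a u
      by (intro ln_exp_bound_piece[where p = "2.5" and q = "3.3" and L = "2.45" and e = "0.0821"]) auto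
  next
    case 5
    then show ?thesis using exp_lower_numeric(1) exp_upper_numeric(3) a u
      by (intro ln_exp_bound_piece[where p = "3.3" and q = 4 and L = "2.64" and e = "0.0369"]) auto
  qed
qed

text \<open>Again each term takes its worse endpoint, now with \<open>a\<close> bounded by
  \<open>0.7216 * D\<close>, where 0.7216 exceeds \<open>1 / (2 * 0.693)\<close>. The constants in
  the last hypothesis are \<open>2 * 0.7216\<close> and \<open>1 + 0.0112\<close>; 0.0112 bounds the
  loss \<open>2 * s\<close>.\<close>

lemma potential_middle_piece:
  fixes a u D :: real
  assumes "0 < a" "a \<le> 0.7216 * D" "5.211 \<le> D" "0 < p" "p \<le> u" "u \<le> q" "t \<le> 0.0112"
    and e: "exp (- p / 2) \<le> e" and l: "ln (q * (0.7216 * D)) \<le> l"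
    and n: "l + 1.4432 * D * e + 1.0112 \<le> D"
  shows "0 \<le> D - t - ln (a * u) - 1 - a * (2 * exp (- u / 2))"
proof -
  define A B E R where "A = ln (a * u)" and "B = a * (2 * exp (- u / 2))" and "E = 0.7216 * D * (2 * e)"
    and "R = ln (q * (0.7216 * D))"
  have "a * u \<le> 0.7216 * D * q"
    using assms by (intro mult_mono) auto
  then have "A \<le> R" unfolding A_def R_def
    using assms by (subst ln_le_cancel_iff) (auto simp: mult.commute)
  moreover have "B \<le> E" unfolding B_def E_def
  proof (intro mult_mono order_refl)
    have "exp (- u / 2) \<le> exp (- p / 2)" using assms by simp
    then show "exp (- u / 2) \<le> e" using e by linarith
  qed (use assms in auto)
  moreover have "l + E + 1.0112 \<le> D"
    using n by (simp add: E_def)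
  moreover have "R \<le> l" using l by (simp only: R_def)
  ultimately have "0 \<le> D - t - A - 1 - B"
    using assms(7) by simp
  then show ?thesis by (simp only: A_def B_def)
qed

text \<open>Logarithms are bounded by tangents at \<open>D = 5.2\<close>, just below the least
  admissible \<open>D\<close>. In the last piece \<open>q\<close> itself grows with
  \<open>D\<close>, which makes the argument of the logarithm quadratic; a second factor
  \<open>D / 5.2\<close> is split off and gets its own tangent.\<close>

lemma potential_middle_bound:
  fixes a u D :: real
  assumes "0 < a" "a \<le> 0.7216 * D" "5.211 \<le> D" "4 \<le> u" "u \<le> 3.1 * D" "t \<le> 0.0112"
  shows "0 \<le> D - t - ln (a * u) - 1 - a * (2 * exp (- u / 2))"
proof -
  consider "u \<le> 6" | "6 \<le> u" "u \<le> 10" | "10 \<le> u" by linarith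
  then show ?thesis
  proof cases
    case 1
    have "ln (6 * (0.7216 * D)) \<le> 3.115 + 6 * (0.7216 * D) / (6 * (0.7216 * 5.2)) - 1"
      using assms exp_lower_numeric(4) by (intro ln_le_tangent) auto
    then show ?thesis
      using assms 1 exp_upper_numeric(4)
      by (intro potential_middle_piece[where p = 4 and q = 6 and e = "0.13535" and l = "3.115 + D / 5.2 - 1"]) auto
  next
    case 2
    have "ln (10 * (0.7216 * D)) \<le> 3.626 + 10 * (0.7216 * D) / (10 * (0.7216 * 5.2)) - 1"
      using assms exp_lower_numeric(5) by (intro ln_le_tangent) auto
    then show ?thesis
      using assms 2 exp_upper_numeric(5)
      by (intro potential_middle_piece[where p = 6 and q = 10 and e = "0.0498" and l = "3.626 + D / 5.2 - 1"]) auto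
  next
    case 3
    have "ln (3.1 * 5.2 * (0.7216 * D)) \<le> 4.103 + 3.1 * 5.2 * (0.7216 * D) / (3.1 * 5.2 * (0.7216 * 5.2)) - 1"
      using assms exp_lower_numeric(6) by (intro ln_le_tangent) auto
    moreover have "ln (D / 5.2) \<le> D / 5.2 - 1"
      using assms by (intro ln_le_minus_one) auto
    moreover have "3.1 * D * (0.7216 * D) = (3.1 * 5.2 * (0.7216 * D)) * (D / 5.2)" by simp
    then have "ln (3.1 * D * (0.7216 * D)) = ln (3.1 * 5.2 * (0.7216 * D)) + ln (D / 5.2)"
      using assms by (simp only:) (intro ln_mult_pos, auto)
    ultimately show ?thesis
      using assms 3 exp_upper_numeric(6)
      by (intro potential_middle_piece[where p = 10 and q = "3.1 * D" and e = "0.00674" and l = "4.103 + D / 5.2 - 1 + (D / 5.2 - 1)"]) auto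
  qed
qed

text \<open>The rate 0.55 is \<open>3.1 / 2 - 1\<close>, so the first part says that
  \<open>y * exp (- y / 2)\<close> is at most \<open>exp (- D)\<close> at
  \<open>y = 3.1 * D\<close>. Both parts expand at 5.2, where
  \<open>0.55 * 5.2 = 2.86\<close>.\<close>

lemma exp_ge_large:
  fixes D :: real
  assumes "5.2 \<le> D"
  shows "3.1 * D \<le> exp (0.55 * D)" "181 * (1 + (D - 5.2) + (D - 5.2)\<^sup>2 / 2) \<le> exp D"
proof -
  have "17.4 * (1 + (0.55 * D - 2.86)) \<le> exp 2.86 * exp (0.55 * D - 2.86)"
    using assms exp_lower_numeric(7) exp_ge_add_one_self[of "0.55 * D - 2.86"] by (intro mult_mono) auto
  also have "\<dots> = exp (0.55 * D)" by (simp add: exp_add[symmetric])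
  finally show "3.1 * D \<le> exp (0.55 * D)" using assms by simp
  have "181 * (1 + (D - 5.2) + (D - 5.2)\<^sup>2 / 2) \<le> exp 5.2 * exp (D - 5.2)"
    using assms exp_lower_numeric(8) exp_lower_Taylor_quadratic[of "D - 5.2"] by (intro mult_mono) auto
  also have "\<dots> = exp D" by (simp add: exp_add[symmetric])
  finally show "181 * (1 + (D - 5.2) + (D - 5.2)\<^sup>2 / 2) \<le> exp D" .
qed

section \<open>The potential\<close>

text \<open>The point \<open>b\<close> is a supersolution, so the intermediate value theorem gives a
  solution in \<open>{s..b}\<close>. The solutions there form a compact set, hence the minimum
  behind \<open>LEAST\<close> is attained; solutions beyond \<open>b\<close> cannot be
  smaller.\<close>

lemma x1_exists:
  assumes "0 < a" "0 < s" "s \<le> b" "g2 (1 / (a * b)) + s \<le> b"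
  shows "char_solution a s (x1 a s)" "s < x1 a s" "x1 a s \<le> b"
proof -
  let ?f = "\<lambda>x. x - s - g2 (1 / (a * x))"
  have cont: "continuous_on {s..b} ?f"
    using assms by (intro continuous_intros continuous_on_compose2[OF continuous_on_g2]) auto
  have "?f s \<le> 0" "0 \<le> ?f b"
    using g2_pos[of "1 / (a * s)"] assms by (auto intro!: less_imp_le)
  then obtain x where x: "s \<le> x" "x \<le> b" "?f x = 0"
    using IVT'[of ?f s 0 b] cont assms(3) by auto
  let ?S = "{s..b} \<inter> ?f -` {0}"
  have "closed ?S"
    by (rule continuous_closed_preimage[OF cont]) auto
  moreover have "bounded ?S"
    by (rule bounded_subset[of "{s..b}"]) auto
  ultimately have "compact ?S"
    by (simp add: compact_eq_bounded_closed)
  moreover have "?S \<noteq> {}" using x by auto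
  ultimately obtain m where m: "m \<in> ?S" "\<And>y. y \<in> ?S \<Longrightarrow> m \<le> y"
    using compact_attains_inf[of ?S] by blast
  have gt: "s < y" if "char_solution a s y" for y
    using that g2_pos[of "1 / (a * y)"] assms by (auto simp: char_solution_def)
  have cm: "char_solution a s m"
    using m(1) assms by (auto simp: char_solution_def)
  have "x1 a s = m"
    unfolding x1_def
  proof (rule Least_equality)
    show "char_solution a s m" by (rule cm)
    fix y assume y: "char_solution a s y"
    show "m \<le> y"
    proof (cases "y \<le> b")
      case True
      then show ?thesis using gt[OF y] y by (intro m(2)) (auto simp: char_solution_def)
    qed (use m(1) in auto)
  qed
  then show "char_solution a s (x1 a s)" "s < x1 a s" "x1 a s \<le> b"
    using cm gt m(1) by auto
qed

lemma potential_snr: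
  assumes "0 < a" "0 < x1 a s" "0 \<le> x"
  defines "u \<equiv> 1 / (a * (x + x1 a s))" and "v \<equiv> 1 / (a * x1 a s)"
  shows "potential s x a = ln v - ln u - s * a * (v - u) - a * integral {u..v} g2"
    and "0 < u" "u \<le> v"
proof -
  have *: "(x + x1 a s) / x1 a s = v / u"
    unfolding u_def v_def using assms by (simp add: field_simps)
  have "ln ((x + x1 a s) / x1 a s) = ln v - ln u"
    unfolding * using assms by (intro ln_divide_pos) (auto simp: u_def v_def add_nonneg_pos)
  moreover have "s * x / (x1 a s * (x + x1 a s)) = s * a * (v - u)"
    unfolding u_def v_def using assms by (simp add: field_simps add_nonneg_pos less_imp_neq[symmetric])
  ultimately show "potential s x a = ln v - ln u - s * a * (v - u) - a * integral {u..v} g2"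
    unfolding potential_def u_def v_def by simp
  show "0 < u" using assms by (simp add: u_def add_nonneg_pos)
  show "u \<le> v" unfolding u_def v_def using assms by (intro divide_left_mono mult_left_mono) auto
qed

lemma mult_exp_half_antimono:
  fixes Y y :: real
  assumes "2 \<le> Y" "Y \<le> y"
  shows "y * exp (- y / 2) \<le> Y * exp (- Y / 2)"
proof -
  have "(y - Y) * 2 \<le> (y - Y) * Y"
    using assms by (intro mult_left_mono) auto
  then have "y \<le> Y * (1 + (y - Y) / 2)"
    by (simp add: field_simps)
  also have "\<dots> \<le> Y * exp ((y - Y) / 2)"
    using assms by (intro mult_left_mono exp_ge_add_one_self) auto
  finally have "y * exp (- y / 2) \<le> Y * exp ((y - Y) / 2) * exp (- y / 2)"
    by (rule mult_right_mono) simp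
  also have "\<dots> = Y * exp (- Y / 2)"
    by (simp add: exp_add[symmetric] diff_divide_distrib)
  finally show ?thesis .
qed

text \<open>Close to the fixed point, the integrand \<open>1 / y - a * s - a * g2 y\<close> of the potential is
  nonnegative: it vanishes at \<open>v\<close>, and the Lipschitz constant of \<open>g2\<close> is tiny there.\<close>

lemma potential_nonneg_near:
  assumes "0 < a" "0 < s" and sol: "char_solution a s (x1 a s)" and gt: "s < x1 a s"
    and "2 \<le> Y" "Y * exp (- Y / 2) \<le> s" "Y \<le> u" "u \<le> v"
    and v: "v = 1 / (a * x1 a s)"
  shows "0 \<le> ln v - ln u - s * a * (v - u) - a * integral {u..v} g2"
proof -
  have u0: "0 < u" using assms by simp
  have v0: "0 < v" using u0 assms by linarith
  have av: "a * v = 1 / x1 a s" using assms by (simp add: v)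
  have gv: "a * g2 v = 1 / v - a * s"
  proof -
    have "g2 v = x1 a s - s" using sol unfolding char_solution_def v by linarith
    then show ?thesis by (simp add: v right_diff_distrib)
  qed
  \<comment> \<open>Relative to the value at \<open>v\<close>, the drop of \<open>a * g2\<close>
    must not exceed \<open>1 / y - 1 / v = (v - y) / (y * v)\<close>. With the slope bound
    \<open>exp (- y / 2)\<close> this needs \<open>a * v * y * exp (- y / 2) \<le> 1\<close>, which
    holds because \<open>a * v * s = s / x1 a s\<close>.\<close>
  have le: "a * g2 y \<le> 1 / y - a * s" if "u \<le> y" "y \<le> v" for y
  proof -
    have y0: "0 < y" using that u0 by simp
    have "y * exp (- y / 2) \<le> s"
      using mult_exp_half_antimono[of Y y] that assms by simp
    then have "a * v * (y * exp (- y / 2)) \<le> a * v * s"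
      using assms v0 by (intro mult_left_mono) auto
    also have "\<dots> \<le> 1"
      unfolding av using gt assms by (simp add: divide_le_eq)
    finally have "a * exp (- y / 2) \<le> 1 / (y * v)"
      using y0 v0 by (simp add: field_simps)
    then have "a * exp (- y / 2) * (v - y) \<le> 1 / (y * v) * (v - y)"
      using that by (intro mult_right_mono) auto
    also have "\<dots> = 1 / y - 1 / v"
      using y0 v0 by (simp add: field_simps)
    finally have "a * (exp (- y / 2) * (v - y)) \<le> 1 / y - 1 / v" by simp
    moreover have "a * (g2 y - g2 v) \<le> a * (exp (- y / 2) * (v - y))"
      using g2_diff_le[OF y0 that(2)] assms by (intro mult_left_mono) auto
    ultimately show ?thesis using gv by (simp add: right_diff_distrib)
  qed
  have int: "((\<lambda>y. a * g2 y) has_integral a * integral {u..v} g2) {u..v}"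
    using integrable_integral[OF g2_integrable_on[OF u0]] by (rule has_integral_mult_right)
  have "((\<lambda>y. ln y - a * s * y) has_real_derivative (1 / y - a * s)) (at y within {u..v})" if "y \<in> {u..v}" for y
    using that u0 by (auto intro!: derivative_eq_intros)
  then have "((\<lambda>y. 1 / y - a * s) has_integral (ln v - a * s * v) - (ln u - a * s * u)) {u..v}"
    by (intro fundamental_theorem_of_calculus[OF \<open>u \<le> v\<close>])
      (simp add: has_real_derivative_iff_has_vector_derivative)
  from has_integral_le[OF int this] le
  have "a * integral {u..v} g2 \<le> (ln v - a * s * v) - (ln u - a * s * u)" by simp
  then show ?thesis by (simp add: algebra_simps)
qed

text \<open>Here \<open>ln (1 + 1 / s)\<close> is \<open>2 * ln 2\<close> times the capacity.\<close>

lemma potential_ge: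
  assumes "0 < a" "0 < s" "s < x1 a s" "x1 a s \<le> s * (1 + s)" "0 < u" "u \<le> v"
    and v: "v = 1 / (a * x1 a s)"
  shows "ln (1 + 1 / s) - 2 * s - ln (a * u) - 1 - a * integral {u..v} g2
       \<le> ln v - ln u - s * a * (v - u) - a * integral {u..v} g2"
proof -
  \<comment> \<open>The loss \<open>2 * s\<close> arises from two uses of
    \<open>ln (1 + s) \<le> s\<close>: once for \<open>x1 a s\<close> against \<open>s\<close>, once
    for \<open>ln s\<close> against \<open>- ln (1 + 1 / s)\<close>.\<close>
  have x0: "0 < x1 a s" using assms by simp
  have "ln (x1 a s) \<le> ln (s * (1 + s))"
    using assms x0 by (subst ln_le_cancel_iff) auto
  also have "\<dots> = ln s + ln (1 + s)"
    using assms by (intro ln_mult_pos) auto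
  also have "ln s = ln (1 + s) - ln (1 + 1 / s)"
  proof -
    have "1 + 1 / s = (1 + s) / s" using assms by (simp add: field_simps)
    then show ?thesis using assms by (simp add: ln_div)
  qed
  also have "ln (1 + s) \<le> s"
    using assms by (intro ln_add_one_self_le_self) simp
  finally have "ln (1 + 1 / s) - 2 * s \<le> - ln (x1 a s)"
    using ln_add_one_self_le_self[of s] assms by simp
  moreover have "ln v = - ln a - ln (x1 a s)"
    using assms x0 by (simp add: v ln_div ln_mult)
  moreover have "s * a * (v - u) \<le> 1"
  proof -
    have "s * a * (v - u) \<le> s * a * v"
      using assms by (intro mult_left_mono) auto
    also have "\<dots> = s / x1 a s" using assms by (simp add: v)
    also have "\<dots> \<le> 1" using assms by simp
    finally show ?thesis .
  qed
  moreover have "ln (a * u) = ln a + ln u"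
    using assms by (intro ln_mult_pos) auto
  ultimately show ?thesis by linarith
qed

section \<open>Consequences of the capacity threshold\<close>

lemma capacity_ln: "capacity s = ln (1 + 1 / s) / (2 * ln 2)"
  by (simp add: capacity_def log_def)

text \<open>The threshold \<open>3.76\<close> is \<open>4.26 - 1 / 2\<close>: replacing \<open>\<sigma>2\<close> by \<open>noise' L \<sigma>2\<close> costs at most half a bit.\<close>

lemma capacity_consequences:
  assumes "0 < s" "3.76 \<le> capacity s"
  defines "D \<equiv> ln (1 + 1 / s)"
  shows "D = 2 * ln 2 * capacity s" "capacity s \<le> 0.7216 * D" "5.211 \<le> D" "exp D = 1 + 1 / s"
    "2.8864 * D\<^sup>2 \<le> 1 / s - 1" "s \<le> 1 / 180" "(capacity s)\<^sup>2 * s \<le> 0.19"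
proof -
  let ?c = "capacity s"
  show D: "D = 2 * ln 2 * ?c"
    unfolding D_def capacity_ln by simp
  have "2 * 0.693 * ?c \<le> D"
    unfolding D using assms ln2_bounds by (intro mult_right_mono) auto
  then show cD: "?c \<le> 0.7216 * D" and D5: "5.211 \<le> D"
    using assms by auto
  show E: "exp D = 1 + 1 / s"
    using assms by (simp add: D_def add_pos_pos)
  \<comment> \<open>The coefficient 2.8864 is \<open>4 * 0.7216\<close>, chosen so that
    \<open>4 * D * a \<le> 1 / s - 1\<close> for loads up to the capacity. Expanding at 5.2 and
    treating the square and \<open>1 / s\<close> as free variables \<open>q\<close> and
    \<open>r\<close> makes the comparison linear.\<close>
  have "181 * (1 + (D - 5.2) + (D - 5.2)\<^sup>2 / 2) \<le> 1 + 1 / s"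
    unfolding E[symmetric] using D5 by (intro exp_ge_large) simp
  moreover have eq: "2.8864 * D\<^sup>2 = 2.8864 * 27.04 + 2.8864 * 10.4 * (D - 5.2) + 2.8864 * (D - 5.2)\<^sup>2"
    by (simp add: power2_eq_square field_simps)
  moreover have "2.8864 * 27.04 + 2.8864 * 10.4 * (D - 5.2) + 2.8864 * q \<le> r - 1"
    if "181 * (1 + (D - 5.2) + q / 2) \<le> 1 + r" "0 \<le> q" for q r :: real
    using that D5 by (simp add: field_simps)
  ultimately show D2: "2.8864 * D\<^sup>2 \<le> 1 / s - 1"
    unfolding eq using zero_le_power2 by blast
  have "181 \<le> exp D"
    using exp_lower_numeric(8) D5 order_trans[of 181 "exp 5.2" "exp D"] by simp
  then show "s \<le> 1 / 180"
    using E assms(1) by (simp add: field_simps)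
  have "?c\<^sup>2 \<le> (0.7216 * D)\<^sup>2"
    using cD assms by (intro power_mono) auto
  also have "\<dots> \<le> 0.1805 * (2.8864 * D\<^sup>2)"
    by (simp add: power_mult_distrib power_divide)
  also have "\<dots> \<le> 0.1805 * (1 / s - 1)"
    using D2 by (intro mult_left_mono) auto
  also have "\<dots> \<le> 0.19 * (1 / s)"
    using assms(1) by (simp add: field_simps)
  finally show "?c\<^sup>2 * s \<le> 0.19"
    using assms(1) by (simp add: field_simps)
qed

text \<open>The supersolution is \<open>s * (1 + s)\<close>: there the SNR is at least
  \<open>4 * D\<close>, so \<open>g2\<close> is at most \<open>exp (- 2 * D)\<close>, which is below
  \<open>s\<^sup>2\<close>. The same estimate holds at every smaller positive \<open>x\<close>, in
  particular at \<open>x1 a s\<close>.\<close>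

lemma x1_small:
  assumes "0 < s" "3.76 \<le> capacity s" "0 < a" "a \<le> capacity s"
  shows "char_solution a s (x1 a s)" "s < x1 a s" "x1 a s \<le> s * (1 + s)"
    "exp (- (1 / (a * x1 a s)) / 2) \<le> s\<^sup>2"
proof -
  define D where "D = ln (1 + 1 / s)"
  note c = capacity_consequences[OF assms(1,2), folded D_def]
  let ?b = "s * (1 + s)"
  have e: "exp (- (1 / (a * x)) / 2) \<le> s\<^sup>2" if "0 < x" "x \<le> ?b" for x
  proof -
    have "4 * a * D \<le> 4 * (0.7216 * D) * D"
      using c(3) assms(3) order_trans[OF assms(4) c(2)] by (intro mult_mono) simp_all
    then have "4 * D * a \<le> 2.8864 * D\<^sup>2"
      by (simp add: power2_eq_square mult_ac)
    also have "\<dots> \<le> 1 / s - 1" by (rule c(5))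
    also have "\<dots> = (1 - s) / s"
      using assms by (simp add: field_simps)
    also have "\<dots> \<le> 1 / ?b"
    proof (subst pos_le_divide_eq)
      have "(1 - s) * (1 + s) \<le> 1" by (simp add: algebra_simps)
      then show "(1 - s) / s * ?b \<le> 1" using assms by simp
    qed (use assms in simp)
    also have "\<dots> \<le> 1 / x"
      using assms that by (intro divide_left_mono) auto
    finally have "4 * D \<le> 1 / (a * x)"
      using assms that by (simp add: field_simps)
    then have "exp (- (1 / (a * x)) / 2) \<le> exp (- (2 * D))"
      by simp
    also have "\<dots> = (1 / (1 + 1 / s))\<^sup>2"
      unfolding c(4)[symmetric] by (simp add: exp_double exp_minus inverse_eq_divide power_divide)
    also have "\<dots> \<le> s\<^sup>2"
      using assms by (intro power_mono) (auto simp: field_simps)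
    finally show ?thesis .
  qed
  have b: "0 < ?b" using assms by simp
  have "g2 (1 / (a * ?b)) \<le> s\<^sup>2"
    by (rule order_trans[OF g2_le e[OF b order_refl]]) (use assms b in simp)
  then have "g2 (1 / (a * ?b)) + s \<le> ?b"
    by (simp add: power2_eq_square algebra_simps)
  moreover have "s \<le> ?b" using assms by simp
  ultimately show x: "char_solution a s (x1 a s)" "s < x1 a s" "x1 a s \<le> ?b"
    using x1_exists[of a s ?b] assms by auto
  show "exp (- (1 / (a * x1 a s)) / 2) \<le> s\<^sup>2"
    using x assms by (intro e) auto
qed

lemma potential_nonneg:
  assumes "0 < s" "3.76 \<le> capacity s" "0 \<le> x"
  defines "a \<equiv> capacity s - 0.9 / capacity s"
  shows "0 \<le> potential s x a"
proof -
  define c where "c = capacity s"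
  define D where "D = ln (1 + 1 / s)"
  note cc = capacity_consequences[OF assms(1,2), folded D_def c_def]
  have c0: "3.76 \<le> c" using assms(2) by (simp add: c_def)
  have a: "a = c - 0.9 / c" by (simp add: a_def c_def)
  have "0.9 / c \<le> 0.24" "0 \<le> 0.9 / c" using c0 by (simp_all add: field_simps)
  then have a0: "7 / 2 \<le> a" "a \<le> c" using c0 by (simp_all add: a)
  have ac: "0 < a" "a \<le> capacity s" using a0 by (simp_all add: c_def)
  note x1 = x1_small[OF assms(1,2) ac]
  define u where "u = 1 / (a * (x + x1 a s))"
  define v where "v = 1 / (a * x1 a s)"
  let ?I = "integral {u..v} g2"
  have x0: "0 < x1 a s" using x1 assms(1) by simp
  note pot = potential_snr[OF ac(1) x0 assms(3), folded u_def v_def]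
  note ge = potential_ge[OF ac(1) assms(1) x1(2,3) pot(2,3) v_def, folded D_def]
  have s2: "2 * s \<le> 0.0112" using cc(6) by simp
  \<comment> \<open>From \<open>3.1 * D\<close> on,
    \<open>y * exp (- y / 2) \<le> exp (- D) \<le> s\<close>, which is the slope condition of
    \<open>potential_nonneg_near\<close>.\<close>
  consider "u \<le> 4" | "4 \<le> u" "u \<le> 3.1 * D" | "3.1 * D \<le> u" by linarith
  then show ?thesis
  proof cases
    case 1
    have "a * ?I \<le> a * (2 * ln 2 - (1 - exp (- u)))"
      using integral_g2_le_tail[OF pot(2,3)] ac by (intro mult_left_mono) auto
    then have I: "a * ?I \<le> 2 * ln 2 * a - a * (1 - exp (- u))"
      by (simp add: algebra_simps)
    have B: "- 1 / a \<le> - ln (a * u) - 1 + a * (1 - exp (- u))"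
      using a0(1) pot(2) 1 by (rule ln_exp_bound)
    \<comment> \<open>This is where 0.9 is fixed: multiplied by \<open>c\<close>, the left side is
      at most \<open>1.07 + 2 * 0.051 = 1.172\<close>, and \<open>2 * ln 2 * 0.9\<close> is at least
      1.247.\<close>
    have "1 / a + 2 * s \<le> 2 * ln 2 * (0.9 / c)"
    proof -
      have "c * s \<le> 0.051"
      proof -
        have "3.76 * (c * s) \<le> c * (c * s)"
          using c0 assms(1) by (intro mult_right_mono) auto
        then show ?thesis using cc(7) by (simp add: power2_eq_square mult.assoc)
      qed
      moreover have "c / a \<le> 1.07"
      proof -
        have "3.76 * 3.76 \<le> c * c" using c0 by (intro mult_mono) auto
        then have "c \<le> 1.07 * a" using c0 by (simp add: a field_simps)
        then show ?thesis using ac by (simp add: field_simps)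
      qed
      moreover have "c * (1 / a + 2 * s) = c / a + 2 * (c * s)"
        by (simp add: algebra_simps)
      ultimately have "c * (1 / a + 2 * s) \<le> 2 * 0.693 * 0.9"
        by simp
      also have "\<dots> \<le> 2 * ln 2 * 0.9"
        using ln2_bounds by simp
      finally show ?thesis
        using c0 by (simp add: field_simps)
    qed
    moreover have "D - 2 * ln 2 * a = 2 * ln 2 * (0.9 / c)"
      unfolding cc(1) a by (simp add: right_diff_distrib)
    ultimately have "0 \<le> D - 2 * s - ln (a * u) - 1 - a * ?I"
      using I B by simp
    then show ?thesis unfolding pot(1) using ge by linarith
  next
    case 2
    have "a * ?I \<le> a * (2 * exp (- u / 2))"
      using integral_g2_le_exp[OF pot(2,3)] ac by (intro mult_left_mono) auto
    moreover have "0 \<le> D - 2 * s - ln (a * u) - 1 - a * (2 * exp (- u / 2))"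
      by (rule potential_middle_bound[OF ac(1) order_trans[OF a0(2) cc(2)] cc(3) 2 s2])
    ultimately show ?thesis unfolding pot(1) using ge by linarith
  next
    case 3
    have "3.1 * D * exp (- (3.1 * D) / 2) \<le> exp (0.55 * D) * exp (- (3.1 * D) / 2)"
      using exp_ge_large(1)[of D] cc(3) by (intro mult_right_mono) auto
    also have "\<dots> = exp (- D)"
      by (simp add: exp_add[symmetric])
    also have "\<dots> = 1 / (1 + 1 / s)"
      by (simp add: exp_minus cc(4) inverse_eq_divide)
    also have "\<dots> \<le> s"
      using assms(1) by (simp add: field_simps)
    finally have Y: "3.1 * D * exp (- (3.1 * D) / 2) \<le> s" .
    show ?thesis
      unfolding pot(1)
      by (rule potential_nonneg_near[OF ac(1) assms(1) x1(1,2) _ Y 3 pot(3) v_def]) (use cc(3) in simp)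
  qed
qed

lemma limiting_load_bounds:
  assumes "0 < s" "3.76 \<le> capacity s"
  shows "capacity s - 0.9 / capacity s \<le> limiting_load s" "limiting_load s \<le> capacity s"
proof -
  let ?c = "capacity s"
  let ?A = "{a \<in> {0<..capacity s}. \<forall>x\<in>{0..1 + s}. 0 \<le> potential s x a}"
  have "0.9 / ?c \<le> 0.24" "0 \<le> 0.9 / ?c" using assms by (simp_all add: field_simps)
  then have mem: "?c - 0.9 / ?c \<in> ?A"
    using assms potential_nonneg[OF assms] by simp
  show "?c - 0.9 / ?c \<le> limiting_load s"
    unfolding limiting_load_def by (rule cSup_upper[OF mem]) (auto intro!: bdd_aboveI[of _ ?c])
  show "limiting_load s \<le> ?c"
    unfolding limiting_load_def by (rule cSup_least[of ?A]) (use mem in blast, auto)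
qed

section \<open>The rate gap\<close>

text \<open>The rescaling of the noise costs precisely the first term of \<open>gap_finite\<close>.
  As \<open>1 / L\<close> is at most 1/2, the ratio inside the logarithm is at most 2.\<close>

lemma capacity_noise':
  assumes "0 < \<sigma>2" "2 \<le> L"
  shows "capacity \<sigma>2 - capacity (noise' L \<sigma>2) = 1 / 2 * log 2 ((\<sigma>2 + 1) / (\<sigma>2 + 1 - 1 / real L))"
    and "capacity \<sigma>2 - capacity (noise' L \<sigma>2) \<le> 1 / 2"
    and "capacity (noise' L \<sigma>2) \<le> capacity \<sigma>2"
proof -
  define i where "i = 1 / real L"
  let ?p = "\<sigma>2 + 1 - 1 / real L"
  have L: "2 \<le> real L" using assms by simp
  then have L': "0 < i" "i \<le> 1 / 2" by (simp_all add: i_def field_simps)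
  have p: "0 < ?p" unfolding i_def[symmetric] using assms L' by simp
  have "1 + 1 / noise' L \<sigma>2 = ?p / \<sigma>2"
    using assms L by (simp add: noise'_def field_simps)
  moreover have "1 + 1 / \<sigma>2 = (\<sigma>2 + 1) / \<sigma>2"
    using assms by (simp add: field_simps)
  ultimately have eq: "capacity \<sigma>2 - capacity (noise' L \<sigma>2) = 1 / 2 * (log 2 (\<sigma>2 + 1) - log 2 ?p)"
    using assms p by (simp add: capacity_def log_divide algebra_simps)
  also have "\<dots> = 1 / 2 * log 2 ((\<sigma>2 + 1) / ?p)"
    using assms p by (simp add: log_divide)
  finally show d: "capacity \<sigma>2 - capacity (noise' L \<sigma>2) = 1 / 2 * log 2 ((\<sigma>2 + 1) / ?p)" .
  have "log 2 (\<sigma>2 + 1) \<le> log 2 (2 * ?p)"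
    using assms p L' unfolding i_def[symmetric] by (intro log_mono) simp_all
  also have "\<dots> = 1 + log 2 ?p"
    using p by (subst log_mult) auto
  finally show "capacity \<sigma>2 - capacity (noise' L \<sigma>2) \<le> 1 / 2"
    unfolding eq by simp
  have "log 2 ?p \<le> log 2 (\<sigma>2 + 1)"
    using assms p L' unfolding i_def[symmetric] by (intro log_mono) simp_all
  then have "0 \<le> capacity \<sigma>2 - capacity (noise' L \<sigma>2)"
    unfolding eq by simp
  then show "capacity (noise' L \<sigma>2) \<le> capacity \<sigma>2" by simp
qed

text \<open>The gap splits as
  \<open>(C - c) + (c - a) + (a - \<alpha>) + \<alpha> * (1 - B)\<close>: noise rescaling, distance
  of the limiting load from capacity, the difference between the two notions of load, and the
  shortfall of each binary stream from one bit. The first and third are covered by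
  \<open>gap_finite\<close>, the others by \<open>gap_asymptotic\<close>.\<close>

lemma rate_gap:
  assumes "0 < \<sigma>2" "4.26 \<le> capacity \<sigma>2" "2 \<le> L" "2 \<le> M"
    and load: "load' L M = limiting_load (noise' L \<sigma>2)"
  shows "capacity \<sigma>2 - real L / real M * capacity_biawgn (1 / (load' L M * x1 (load' L M) (noise' L \<sigma>2)))
    \<le> gap_asymptotic \<sigma>2 + gap_finite L M \<sigma>2"
proof -
  define s where "s = noise' L \<sigma>2"
  define a where "a = load' L M"
  define C where "C = capacity \<sigma>2"
  define c where "c = capacity s"
  define B where "B = capacity_biawgn (1 / (a * x1 a s))"
  note dC = capacity_noise'[OF assms(1,3), folded s_def C_def c_def]
  have C: "4.26 \<le> C" using assms by (simp add: C_def)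
  then have c: "3.76 \<le> c" using dC(2) by simp
  have s: "0 < s" using assms by (simp add: s_def noise'_def)
  note cc = capacity_consequences[OF s c[unfolded c_def], folded c_def]
  have al: "a = limiting_load s" using load by (simp add: a_def s_def)
  have ac: "c - 0.9 / c \<le> a" "a \<le> c"
    using limiting_load_bounds[OF s c[unfolded c_def]] by (simp_all add: al c_def)
  have "0.9 / c \<le> 0.24" using c by (simp add: field_simps)
  then have a1: "1 \<le> a" using ac c by simp
  note x1 = x1_small[OF s c[unfolded c_def], of a, folded c_def]
  let ?v = "1 / (a * x1 a s)"
  have "1 - s\<^sup>2 / ln 2 \<le> 1 - exp (- ?v / 2) / ln 2"
    using x1(4) a1 ac by (simp add: divide_right_mono)
  also have "\<dots> \<le> B"
    unfolding B_def using x1(2) a1 ac s by (intro capacity_biawgn_ge) auto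
  finally have B: "1 - s\<^sup>2 / ln 2 \<le> B" .
  have M: "2 \<le> real M" using assms by simp
  define \<alpha> where "\<alpha> = real L / real M"
  have "a * (real M - 1) = real L - 1" using M by (simp add: a_def load'_def)
  then have \<alpha>: "\<alpha> = a - (a - 1) / real M"
    using M by (simp add: \<alpha>_def field_simps)
  have \<alpha>0: "0 \<le> \<alpha>" "\<alpha> \<le> c"
  proof -
    show "0 \<le> \<alpha>" by (simp add: \<alpha>_def)
    have "0 \<le> (a - 1) / real M" using a1 by simp
    then show "\<alpha> \<le> c" using \<alpha> ac by linarith
  qed
  have fin: "(a - 1) / real M \<le> (C - 1) / (real M - 1)"
    using a1 ac dC(3) M by (intro frac_le) auto
  \<comment> \<open>The bit shortfall is negligible: the square of \<open>c * s\<close> is at most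
    \<open>0.19 / 180\<close>, below \<open>0.002 * ln 2\<close>.\<close>
  have eps: "c * (s\<^sup>2 / ln 2) \<le> 0.002 / c"
  proof -
    have "c\<^sup>2 * s * s \<le> 0.19 * (1 / 180)"
      using cc(6,7) s by (intro mult_mono) auto
    also have "\<dots> \<le> 0.002 * 0.693" by simp
    also have "\<dots> \<le> 0.002 * ln 2" using ln2_bounds by simp
    finally show ?thesis
      using c by (simp add: field_simps power2_eq_square)
  qed
  \<comment> \<open>The total 0.902 is \<open>0.9 + 0.002\<close>; the rest of 1.081 pays for
    replacing \<open>c\<close> by \<open>C\<close>, where \<open>C \<le> c + 1 / 2\<close>.\<close>
  have asy: "0.902 / c \<le> 1.081 / C"
  proof -
    have "0.902 * C \<le> 1.081 * c" using dC(2) c by simp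
    then show ?thesis using c C by (simp add: field_simps)
  qed
  have "\<alpha> * (1 - s\<^sup>2 / ln 2) \<le> \<alpha> * B"
    using B \<alpha>0 by (intro mult_left_mono) auto
  moreover have "\<alpha> * (s\<^sup>2 / ln 2) \<le> c * (s\<^sup>2 / ln 2)"
    using \<alpha>0 by (intro mult_right_mono) auto
  ultimately have "\<alpha> - 0.002 / c \<le> \<alpha> * B"
    using eps by (simp add: right_diff_distrib)
  moreover have "0.9 / c + 0.002 / c = 0.902 / c" by (simp add: add_divide_distrib[symmetric])
  ultimately have "c - \<alpha> * B \<le> 1.081 / C + (C - 1) / (real M - 1)"
    using ac(1) \<alpha> fin asy by simp
  then have "C - \<alpha> * B \<le> 1.081 / C + ((C - c) + (C - 1) / (real M - 1))" by simp
  then show ?thesis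
    unfolding gap_asymptotic_def gap_finite_def dC(1) C_def[symmetric] a_def[symmetric] s_def[symmetric]
      \<alpha>_def[symmetric] B_def[symmetric]
    by simp
qed

lemma gap_finite_tendsto_0:
  assumes "0 < \<sigma>2"
  shows "((\<lambda>(L, M). gap_finite L M \<sigma>2) \<longlongrightarrow> 0) (sequentially \<times>\<^sub>F sequentially)"
proof -
  let ?K = "capacity \<sigma>2 - 1"
  have 1: "(\<lambda>L. 1 / 2 * log 2 ((\<sigma>2 + 1) / (\<sigma>2 + 1 - 1 / real L))) \<longlonglongrightarrow> 0"
  proof -
    have "(\<lambda>L. 1 / 2 * log 2 ((\<sigma>2 + 1) / (\<sigma>2 + 1 - 1 / real L))) \<longlonglongrightarrow> 1 / 2 * log 2 ((\<sigma>2 + 1) / (\<sigma>2 + 1 - 0))"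
      using assms by (intro tendsto_intros lim_1_over_n) auto
    then show ?thesis using assms by simp
  qed
  have 2: "(\<lambda>M. ?K / (real M - 1)) \<longlonglongrightarrow> 0"
    by real_asymp
  have "((\<lambda>p. 1 / 2 * log 2 ((\<sigma>2 + 1) / (\<sigma>2 + 1 - 1 / real (fst p))) + ?K / (real (snd p) - 1)) \<longlongrightarrow> 0 + 0)
      (sequentially \<times>\<^sub>F sequentially)"
    by (intro tendsto_add filterlim_compose[OF 1 filterlim_fst] filterlim_compose[OF 2 filterlim_snd])
  then show ?thesis by (simp add: gap_finite_def case_prod_beta')
qed

lemma gap_asymptotic_tendsto_0: "(gap_asymptotic \<longlongrightarrow> 0) (at_right 0)"
  unfolding gap_asymptotic_def[abs_def] capacity_ln by real_asymp

theorem theorem1: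
  fixes \<sigma>2 :: real
  assumes "\<sigma>2 > 0" and "capacity \<sigma>2 \<ge> 4.26"
  shows "(\<forall>L M :: nat. L \<ge> 2 \<and> M \<ge> 2 \<and> load' L M = limiting_load (noise' L \<sigma>2) \<longrightarrow>
            (\<exists>Wbar::nat. Wbar > 0 \<and> (\<forall>W::nat. W > Wbar \<longrightarrow>
               capacity \<sigma>2 - sum_rate Wbar W L M \<sigma>2 \<le> gap_asymptotic \<sigma>2 + gap_finite L M \<sigma>2)))
       \<and> ((\<lambda>(L, M). gap_finite L M \<sigma>2) \<longlongrightarrow> 0) (sequentially \<times>\<^sub>F sequentially)
       \<and> (gap_asymptotic \<longlongrightarrow> 0) (at_right 0)"
proof (intro conjI allI impI)
  fix L M :: nat
  assume LM: "L \<ge> 2 \<and> M \<ge> 2 \<and> load' L M = limiting_load (noise' L \<sigma>2)"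
  show "\<exists>Wbar::nat. Wbar > 0 \<and> (\<forall>W::nat. W > Wbar \<longrightarrow>
      capacity \<sigma>2 - sum_rate Wbar W L M \<sigma>2 \<le> gap_asymptotic \<sigma>2 + gap_finite L M \<sigma>2)"
    \<comment> \<open>Any positive window threshold would do: it is a parameter of
      \<open>sum_rate\<close>, so larger windows select the branch with \<open>x1\<close> once the
      load equals the limiting load.\<close>
    using rate_gap[OF assms, of L M] LM by (intro exI[of _ 1]) (simp add: sum_rate_def)
qed (use assms gap_finite_tendsto_0 gap_asymptotic_tendsto_0 in auto)

end
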